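(* Fix a difference equation $\pmb\omega=(1/f,q,w)$. Let $$\mathbf{A}(a_{11},b_{21}):=\left [\begin{array} {cccc}a_{11}&-1&\bar{z}&0\\ z&0&b_{21}&1\end{array} \right ] \in \mathcal{O}_{2,4}^{\mathbb{C}},$$ and let $$\mathbf{S}_3:=\left [\begin{array} {cccc}1&0&0&0\\ 0&0&b_{21}&1\end{array} \right ],\qquad \mathbf{S}_4:=\left [\begin{array} {cccc}a_{11}&-1&0&0\\ 0&0&1&0\end{array} \right ].$$ Then $(\pmb\omega, \mathbf{A}(a_{11},b_{21}))$ has exactly $N$ eigenvalues if $a_{11}\neq -f_0$ and exactly $N-1$ eigenvalues if $a_{11}=-f_0$; $(\pmb\omega, \mathbf{S}_3)$ has exactly $N$ eigenvalues in any case; $(\pmb\omega, \mathbf{S}_4)$ has exactly $N-1$ eigenvalues if $a_{11}\neq -f_0$ and exactly $N-2$ eigenvalues if $a_{11}=-f_0$. Further, for any $a_{11}^{(1)}<a_{11}^{(2)}\leq -f_0<a_{11}^{(3)}<a_{11}^{(4)}$ and $b_{21}^{(1)}<b_{21}^{(2)}$: (i) the eigenvalues $\lambda_n(a_{11}^{(i)})$ of $(\pmb\omega, \mathbf{A}(a_{11}^{(i)},b_{21}))$, $i=1,\dots,4$, and $\lambda_n(\mathbf{S}_3)$ of $(\pmb\omega,\mathbf{S}_3)$ satisfy $$\lambda_0(a_{11}^{(3)})\leq\lambda_0(a_{11}^{(4)})\leq\lambda_0(\mathbf{S}_3)\leq\lambda_0(a_{11}^{(1)})\leq\lambda_0(a_{11}^{(2)})\leq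 \lambda_1(a_{11}^{(3)})\leq\lambda_1(a_{11}^{(4)})\leq \lambda_1(\mathbf{S}_3)\leq\lambda_1(a_{11}^{(1)})\leq\lambda_1(a_{11}^{(2)})\leq \cdots\leq \lambda_{N-2}(a_{11}^{(3)})\leq\lambda_{N-2}(a_{11}^{(4)})\leq\lambda_{N-2}(\mathbf{S}_3)\leq\lambda_{N-2}(a_{11}^{(1)})\leq\lambda_{N-2}(a_{11}^{(2)})\leq \lambda_{N-1}(a_{11}^{(3)})\leq\lambda_{N-1}(a_{11}^{(4)})\leq\lambda_{N-1}(\mathbf{S}_3)\leq\lambda_{N-1}(a_{11}^{(1)}),$$ and in addition $\lambda_{N-1}(a_{11}^{(1)})\leq\lambda_{N-1}(a_{11}^{(2)})$ if $a_{11}^{(2)}<-f_0$; (ii) the eigenvalues $\lambda_n(b_{21}^{(j)})$ of $(\pmb\omega, \mathbf{A}(a_{11},b_{21}^{(j)}))$, $j=1,2$, and $\lambda_n(\mathbf{S}_4)$ of $(\pmb\omega, \mathbf{S}_4)$ satisfy $$\lambda_0(b_{21}^{(1)})\leq\lambda_0(b_{21}^{(2)})\leq\lambda_0(\mathbf{S}_4)\leq\lambda_1(b_{21}^{(1)})\leq \lambda_1(b_{21}^{(2)})\leq\lambda_1(\mathbf{S}_4)\leq\cdots\leq \lambda_{N-3}(b_{21}^{(1)})\leq\lambda_{N-3}(b_{21}^{(2)})\leq\lambda_{N-3}(\mathbf{S}_4)\leq \lambda_{N-2}(b_{21}^{(1)})\leq\lambda_{N-2}(b_{21}^{(2)}),$$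 and in addition $\lambda_{N-2}(b_{21}^{(2)})\leq \lambda_{N-2}(\mathbf{S}_4)\leq\lambda_{N-1}(b_{21}^{(1)})\leq\lambda_{N-1}(b_{21}^{(2)})$ if $a_{11}\neq -f_0$.
   Context: Discrete Sturm–Liouville problem: equation $-\nabla(f_n\Delta y_n)+q_ny_n=\lambda w_ny_n$, $n\in[1,N]$, $N\ge2$, with real $f_n\neq0$ ($0\le n\le N$), real $q_n$, $w_n>0$ ($1\le n\le N$), abbreviated $\pmb\omega=(1/f,q,w)$; boundary condition $A(y_0, f_0\Delta y_0)^T+B(y_N,f_N\Delta y_N)^T=0$ with $\operatorname{rank}(A,B)=2$, denoted $[A\,|\,B]$ (an equivalence class modulo left multiplication by invertible $2\times2$ matrices), self-adjoint: $AJA^*=BJB^*$, $J=\begin{pmatrix}0&1\\-1&0\end{pmatrix}$. $\mathcal{O}_{2,4}^{\mathbb{C}}$ is the set of BCs $\left[\begin{smallmatrix}a_{11}&-1&\bar z&0\\ z&0&b_{21}&1\end{smallmatrix}\right]$ with $a_{11},b_{21}\in\mathbb{R}$, $z\in\mathbb{C}$. All eigenvalues are real and are counted with multiplicity and listed in non-decreasing order $\lambda_0\le\lambda_1\le\cdots$. *)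

theory Defs
  imports Complex_Main "HOL-Library.Multiset" "HOL-Library.Function_Algebras"
begin

text \<open>Discrete Sturm--Liouville problem
  -nabla(f_n Delta y_n) + q_n y_n = lambda w_n y_n, n in [1,N],
  with Delta y_n = y_(n+1) - y_n, nabla z_n = z_n - z_(n-1).
  A solution is a complex sequence y_0, ..., y_(N+1); we normalise y n = 0 for n > N+1.
  A boundary condition [A | B] is given as a 2x4 complex matrix M (rows 0,1; columns 0..3),
  M = (A, B), and reads  A (y_0, f_0 Delta y_0)^T + B (y_N, f_N Delta y_N)^T = 0.\<close>

type_synonym bcmat = "nat \<Rightarrow> nat \<Rightarrow> complex"

definition sl_eq :: "nat \<Rightarrow> (nat \<Rightarrow> real) \<Rightarrow> (nat \<Rightarrow> real) \<Rightarrow> (nat \<Rightarrow> real)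
    \<Rightarrow> complex \<Rightarrow> (nat \<Rightarrow> complex) \<Rightarrow> bool" where
  "sl_eq N f q w lam y \<longleftrightarrow>
     (\<forall>n\<in>{1..N}.
        - (of_real (f n) * (y (n+1) - y n) - of_real (f (n-1)) * (y n - y (n-1)))
        + of_real (q n) * y n = lam * of_real (w n) * y n)"

definition bc_holds :: "nat \<Rightarrow> (nat \<Rightarrow> real) \<Rightarrow> bcmat \<Rightarrow> (nat \<Rightarrow> complex) \<Rightarrow> bool" where
  "bc_holds N f M y \<longleftrightarrow>
     (\<forall>i<2. M i 0 * y 0 + M i 1 * (of_real (f 0) * (y 1 - y 0))
            + M i 2 * y N + M i 3 * (of_real (f N) * (y (N+1) - y N)) = 0)"

definition sol_space :: "nat \<Rightarrow> (nat \<Rightarrow> real) \<Rightarrow> (nat \<Rightarrow> real) \<Rightarrow> (nat \<Rightarrow> real)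
    \<Rightarrow> bcmat \<Rightarrow> complex \<Rightarrow> (nat \<Rightarrow> complex) set" where
  "sol_space N f q w M lam =
     {y. (\<forall>n>N+1. y n = 0) \<and> sl_eq N f q w lam y \<and> bc_holds N f M y}"

definition is_eigenvalue :: "nat \<Rightarrow> (nat \<Rightarrow> real) \<Rightarrow> (nat \<Rightarrow> real) \<Rightarrow> (nat \<Rightarrow> real)
    \<Rightarrow> bcmat \<Rightarrow> complex \<Rightarrow> bool" where
  "is_eigenvalue N f q w M lam \<longleftrightarrow> (\<exists>y\<in>sol_space N f q w M lam. y \<noteq> (\<lambda>_. 0))"

definition eig_mult :: "nat \<Rightarrow> (nat \<Rightarrow> real) \<Rightarrow> (nat \<Rightarrow> real) \<Rightarrow> (nat \<Rightarrow> real)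
    \<Rightarrow> bcmat \<Rightarrow> complex \<Rightarrow> nat" where
  "eig_mult N f q w M lam =
     vector_space.dim (\<lambda>(c::complex) (y::nat \<Rightarrow> complex) n. c * y n) (sol_space N f q w M lam)"

definition eig_mset :: "nat \<Rightarrow> (nat \<Rightarrow> real) \<Rightarrow> (nat \<Rightarrow> real) \<Rightarrow> (nat \<Rightarrow> real)
    \<Rightarrow> bcmat \<Rightarrow> complex multiset" where
  "eig_mset N f q w M = (THE S. \<forall>lam. count S lam = eig_mult N f q w M lam)"

definition num_eig :: "nat \<Rightarrow> (nat \<Rightarrow> real) \<Rightarrow> (nat \<Rightarrow> real) \<Rightarrow> (nat \<Rightarrow> real)
    \<Rightarrow> bcmat \<Rightarrow> nat" where
  "num_eig N f q w M = size (eig_mset N f q w M)"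

text \<open>lambda_n: the n-th eigenvalue (from 0) in non-decreasing order (all eigenvalues are real).\<close>
definition eig :: "nat \<Rightarrow> (nat \<Rightarrow> real) \<Rightarrow> (nat \<Rightarrow> real) \<Rightarrow> (nat \<Rightarrow> real)
    \<Rightarrow> bcmat \<Rightarrow> nat \<Rightarrow> real" where
  "eig N f q w M n = sorted_list_of_multiset (image_mset Re (eig_mset N f q w M)) ! n"

definition bcA :: "complex \<Rightarrow> real \<Rightarrow> real \<Rightarrow> bcmat" where
  "bcA z a11 b21 = (\<lambda>i j. if i = 0 then [of_real a11, -1, cnj z, 0] ! j
                          else [z, 0, of_real b21, 1] ! j)"

definition bcS3 :: "real \<Rightarrow> bcmat" where
  "bcS3 b21 = (\<lambda>i j. if i = 0 then [1, 0, 0, 0] ! j else [0, 0, of_real b21, 1] ! j)"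

definition bcS4 :: "real \<Rightarrow> bcmat" where
  "bcS4 a11 = (\<lambda>i j. if i = 0 then [of_real a11, -1, 0, 0] ! j else [0, 0, 1, 0] ! j)"

end

theory Submission
  imports Defs "HOL-Analysis.Analysis"
begin

text \<open>Eliminating y (N+1) and y 0 by means of the boundary condition turns each problem into the
  eigenvalue problem of a Hermitian form on a space of sequences supported on 1..N, with respect to
  the inner product weighted by w. With t = a11 + f 0 and ell x = f 0 * x 1 - cnj z * x N, the form
  of A(a11, b21) is h + b21 |x N|^2 - |ell x|^2 / t on the whole space if t is nonzero, and
  h + b21 |x N|^2 on the kernel of ell if t = 0; S3 is the limit of infinite t and S4 is the
  restriction to x N = 0. The number of eigenvalues is the dimension of the space, and all
  inequalities are monotonicity in the form or Cauchy interlacing for a restriction to a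
  hyperplane, both consequences of the min-max principle.\<close>

subsection \<open>Hermitian forms on finitely supported sequences\<close>

text \<open>The critical value -f 0 comes from expanding f 0 * (y 1 - y 0) in the first row of
  A(a11, b21): the coefficient of y 0 becomes a11 + f 0. Along the chain in (i), 1 / t decreases
  from large positive values through 0 to large negative ones, so -|ell x|^2 / t increases
  throughout; S3 sits where 1 / t = 0. As t tends to 0 from below, the form tends to plus infinity
  off the kernel of ell, and from above to minus infinity; hence one eigenvalue is lost at t = 0,
  and passing from a2 to a3 costs one index.

  The signs of f are arbitrary, so no definiteness of the form is at hand; minimisation over the
  compact unit sphere of \<open>ip\<close> replaces it. Multiplicities are dimensions of complex
  solution spaces at complex \<open>lam\<close>, so the reduction to a form has to preserve these
  dimensions for every \<open>lam\<close>, including the degenerate case t = 0, where y 0 is not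
  fixed by the boundary condition but appears as a Lagrange multiplier.\<close>

definition cscale :: "complex \<Rightarrow> (nat \<Rightarrow> complex) \<Rightarrow> nat \<Rightarrow> complex"  (infixr "*\<^sub>c" 75) where
  "c *\<^sub>c y = (\<lambda>n. c * y n)"

lemma cscale_apply: "(c *\<^sub>c y) n = c * y n"
  by (simp add: cscale_def)

text \<open>As rewrite rules these would turn every sum of sequences into a lambda abstraction.\<close>
declare plus_fun_apply [simp del] zero_fun_apply [simp del] minus_apply [simp del]

lemmas seq_apply = plus_fun_apply zero_fun_apply minus_apply cscale_apply

interpretation cfun: vector_space cscale
  by unfold_locales (auto simp: fun_eq_iff algebra_simps seq_apply)

lemma fun_sum_apply: "(\<Sum>i\<in>A. g i) n = (\<Sum>i\<in>A. g i n)"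
  for g :: "'a \<Rightarrow> nat \<Rightarrow> complex"
  by (induction A rule: infinite_finite_induct) (auto simp: seq_apply)

definition supported :: "nat \<Rightarrow> (nat \<Rightarrow> complex) set" where
  "supported N = {x. \<forall>n. n \<notin> {1..N} \<longrightarrow> x n = 0}"

definition unit_seq :: "nat \<Rightarrow> nat \<Rightarrow> complex" where
  "unit_seq k = (\<lambda>n. if n = k then 1 else 0)"

text \<open>Forms live on all sequences, an infinite-dimensional space with the product topology, so
  continuity is not automatic. It is demanded of the quadratic form only, which is what attaining a
  minimum requires; conjugate linearity in the second argument follows from the symmetry.\<close>

definition herm_form :: "((nat \<Rightarrow> complex) \<Rightarrow> (nat \<Rightarrow> complex) \<Rightarrow> complex) \<Rightarrow> bool" where
  "herm_form h \<longleftrightarrow>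
     (\<forall>x y v. h (x + y) v = h x v + h y v) \<and>
     (\<forall>c x v. h (c *\<^sub>c x) v = c * h x v) \<and>
     (\<forall>x y. h y x = cnj (h x y)) \<and>
     continuous_on UNIV (\<lambda>x. h x x)"

lemma herm_formD:
  assumes "herm_form h"
  shows "h (x + y) v = h x v + h y v" "h (c *\<^sub>c x) v = c * h x v"
    "h v (x + y) = h v x + h v y" "h v (c *\<^sub>c x) = cnj c * h v x"
    "cnj (h x y) = h y x" "continuous_on UNIV (\<lambda>x. h x x)"
proof -
  have herm: "cnj (h x y) = h y x" for x y
    using assms unfolding herm_form_def by (metis complex_cnj_cnj)
  show 1: "h (x + y) v = h x v + h y v" and 2: "h (c *\<^sub>c x) v = c * h x v" for x y v c
    using assms unfolding herm_form_def by blast+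
  show "h v (x + y) = h v x + h v y"
    using 1[of x y v] by (simp flip: herm[of _ v])
  show "h v (c *\<^sub>c x) = cnj c * h v x"
    using 2[of c x v] by (simp flip: herm[of _ v])
  show "cnj (h x y) = h y x" by (rule herm)
  show "continuous_on UNIV (\<lambda>x. h x x)"
    using assms unfolding herm_form_def by blast
qed

lemma herm_form_real: "herm_form h \<Longrightarrow> h x x = of_real (Re (h x x))"
  by (metis Reals_cnj_iff herm_formD(5) of_real_Re)

lemma herm_form_sum:
  assumes "herm_form h"
  shows "h (\<Sum>i\<in>A. (c i *\<^sub>c u i)) v = (\<Sum>i\<in>A. c i * h (u i) v)"
proof -
  have z: "h 0 v = 0"
    using herm_formD(2)[OF assms, of 0 0 v] by simp
  show ?thesis
    by (induction A rule: infinite_finite_induct) (simp_all add: z herm_formD[OF assms])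
qed

lemma herm_form_sum_right:
  assumes "herm_form h"
  shows "h v (\<Sum>i\<in>A. (c i *\<^sub>c u i)) = (\<Sum>i\<in>A. cnj (c i) * h v (u i))"
proof -
  have "h v (\<Sum>i\<in>A. (c i *\<^sub>c u i)) = cnj (h (\<Sum>i\<in>A. (c i *\<^sub>c u i)) v)"
    by (simp add: herm_formD(5)[OF assms])
  also have "\<dots> = (\<Sum>i\<in>A. cnj (c i) * h v (u i))"
    by (simp add: herm_form_sum[OF assms] herm_formD(5)[OF assms])
  finally show ?thesis .
qed

lemma continuous_coord:
  "continuous_on S (\<lambda>x::nat \<Rightarrow> complex. x n)"
  by (rule continuous_on_subset[OF continuous_on_product_coordinates subset_UNIV])

locale weighted =
  fixes N :: nat and w :: "nat \<Rightarrow> real"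
  assumes w_pos: "n \<in> {1..N} \<Longrightarrow> w n > 0"
begin

definition ip :: "(nat \<Rightarrow> complex) \<Rightarrow> (nat \<Rightarrow> complex) \<Rightarrow> complex" where
  "ip x y = (\<Sum>n=1..N. of_real (w n) * x n * cnj (y n))"

lemma herm_form_ip: "herm_form ip"
proof -
  have "continuous_on UNIV (\<lambda>x. ip x x)"
    unfolding ip_def
    by (intro continuous_on_sum continuous_on_mult continuous_on_cnj continuous_on_const continuous_coord)
  thus ?thesis
    unfolding herm_form_def ip_def
    by (auto simp: algebra_simps sum.distrib sum_distrib_left seq_apply)
qed

lemma ip_self: "ip x x = of_real (\<Sum>n=1..N. w n * (cmod (x n))\<^sup>2)"
  unfolding ip_def of_real_sum
  by (rule sum.cong) (auto simp: complex_norm_square[symmetric] mult.assoc simp del: of_real_power)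

lemma ip_self_pos:
  assumes "x \<in> supported N" "x \<noteq> 0"
  shows "Re (ip x x) > 0"
proof -
  obtain k where k: "x k \<noteq> 0" using assms(2) by (auto simp: fun_eq_iff seq_apply)
  hence "k \<in> {1..N}" using assms(1) by (auto simp: supported_def)
  with k w_pos have "(\<Sum>n=1..N. w n * (cmod (x n))\<^sup>2) > 0"
    by (intro sum_pos2[of _ k]) (auto intro!: mult_pos_pos mult_nonneg_nonneg simp: less_imp_le)
  thus ?thesis by (simp add: ip_self)
qed

text \<open>Norm 1 bounds coordinate \<open>n\<close> by \<open>1 / sqrt (w n)\<close> and the
  support fixes all others at 0, so the sphere is a closed subset of a product of compact sets,
  compact by Tychonoff.\<close>

lemma compact_unit_sphere:
  assumes "closed U" "U \<subseteq> supported N"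
  shows "compact {x\<in>U. ip x x = 1}"
proof -
  define C :: "nat \<Rightarrow> complex set"
    where "C n = (if n \<in> {1..N} then cball 0 (1 / sqrt (w n)) else {0})" for n
  have "compactin (product_topology (\<lambda>_. euclidean) UNIV) (PiE UNIV C)"
    unfolding compactin_PiE by (auto simp: C_def)
  hence C: "compact (PiE UNIV C)"
    by (simp add: euclidean_product_topology)
  have "{x\<in>U. ip x x = 1} = PiE UNIV C \<inter> (U \<inter> {x. ip x x = 1})"
  proof (intro equalityI subsetI)
    fix x assume "x \<in> {x\<in>U. ip x x = 1}"
    hence x: "x \<in> U" "ip x x = 1" by auto
    have "x n \<in> C n" for n
    proof -
      show ?thesis
      proof (cases "n \<in> {1..N}")
        case True
        have "1 = (\<Sum>n=1..N. w n * (cmod (x n))\<^sup>2)"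
          using x(2) unfolding ip_self by (metis of_real_eq_1_iff)
        also have "\<dots> \<ge> w n * (cmod (x n))\<^sup>2"
          by (rule member_le_sum) (use True w_pos in \<open>auto intro!: mult_nonneg_nonneg simp: less_imp_le\<close>)
        finally have "(cmod (x n))\<^sup>2 \<le> 1 / w n"
          using w_pos[OF True] by (simp add: field_simps)
        hence "cmod (x n) \<le> sqrt (1 / w n)"
          by (simp add: real_le_rsqrt)
        thus ?thesis using True by (simp add: C_def real_sqrt_divide)
      next
        case False
        thus ?thesis using x(1) assms(2) by (auto simp: C_def supported_def)
      qed
    qed
    thus "x \<in> PiE UNIV C \<inter> (U \<inter> {x. ip x x = 1})" using x by (simp add: PiE_def)
  qed auto
  moreover have "closed {x. ip x x = 1}"
    by (rule closed_Collect_eq[OF herm_formD(6)[OF herm_form_ip]]) (rule continuous_on_const)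
  ultimately show ?thesis
    using C assms(1) by (simp add: compact_Int_closed closed_Int)
qed

text \<open>A minimiser of the Rayleigh quotient is an eigenvector: with k = h - \<mu> ip, which is positive
  semidefinite and vanishes at u, expanding k at u + s k(u,v) v for small real s forces k(u,v) = 0.\<close>
lemma eigenvector_exists:
  assumes h: "herm_form h" and U: "cfun.subspace U" "closed U" "U \<subseteq> supported N" "U \<noteq> {0}"
  shows "\<exists>u\<in>U. ip u u = 1 \<and> (\<forall>v\<in>U. h u v = of_real (Re (h u u)) * ip u v)"
proof -
  note hD = herm_formD[OF h] and iD = herm_formD[OF herm_form_ip]
  let ?K = "{x\<in>U. ip x x = 1}"
  have normal: "\<exists>c::real. c > 0 \<and> ip (of_real c *\<^sub>c x) (of_real c *\<^sub>c x) = 1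
      \<and> c\<^sup>2 * Re (ip x x) = 1"
    if x: "x \<in> U" "x \<noteq> 0" for x
  proof -
    have p: "Re (ip x x) > 0" using ip_self_pos x U(3) by auto
    define c where "c = 1 / sqrt (Re (ip x x))"
    have c2: "c\<^sup>2 * Re (ip x x) = 1" using p by (simp add: c_def power_divide)
    have "ip (of_real c *\<^sub>c x) (of_real c *\<^sub>c x) = of_real (c\<^sup>2) * ip x x"
      by (simp add: iD power2_eq_square)
    also have "\<dots> = of_real (c\<^sup>2 * Re (ip x x))"
      by (subst herm_form_real[OF herm_form_ip]) simp
    finally have "ip (of_real c *\<^sub>c x) (of_real c *\<^sub>c x) = 1" by (simp only: c2 of_real_1)
    moreover have "c > 0" using p by (simp add: c_def)
    ultimately show ?thesis using c2 by blast
  qed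
  have "0 \<in> U" using U(1) cfun.subspace_0 by blast
  then obtain x0 where x0: "x0 \<in> U" "x0 \<noteq> 0" using U(4) by blast
  then obtain c :: real where "ip (of_real c *\<^sub>c x0) (of_real c *\<^sub>c x0) = 1"
    using normal by blast
  moreover have "of_real c *\<^sub>c x0 \<in> U" using x0(1) U(1) by (rule cfun.subspace_scale[rotated])
  ultimately have "?K \<noteq> {}" by blast
  moreover have "continuous_on ?K (\<lambda>x. Re (h x x))"
    by (rule continuous_on_Re[OF continuous_on_subset[OF hD(6) subset_UNIV]])
  ultimately obtain u where u: "u \<in> U" "ip u u = 1" and
    min: "\<And>y. y \<in> U \<Longrightarrow> ip y y = 1 \<Longrightarrow> Re (h u u) \<le> Re (h y y)"
    using continuous_attains_inf[OF compact_unit_sphere[OF U(2,3)]] by fastforce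
  define \<mu> where "\<mu> = Re (h u u)"
  have ge: "\<mu> * Re (ip x x) \<le> Re (h x x)" if x: "x \<in> U" for x
  proof (cases "x = 0")
    case True
    have "h 0 0 = 0" "ip 0 0 = 0"
      using hD(2)[of 0 0 0] iD(2)[of 0 0 0] by simp_all
    thus ?thesis using True by simp
  next
    case False
    obtain c :: real where c: "c > 0" "ip (of_real c *\<^sub>c x) (of_real c *\<^sub>c x) = 1"
      "c\<^sup>2 * Re (ip x x) = 1" using normal[OF x False] by blast
    have "\<mu> \<le> Re (h (of_real c *\<^sub>c x) (of_real c *\<^sub>c x))"
      unfolding \<mu>_def by (rule min) (simp_all add: c x U(1) cfun.subspace_scale)
    also have "\<dots> = c\<^sup>2 * Re (h x x)" by (simp add: hD power2_eq_square)
    finally have "c\<^sup>2 * (\<mu> * Re (ip x x)) \<le> c\<^sup>2 * Re (h x x)"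
      using c(3) by (simp add: mult.left_commute)
    thus ?thesis using c(1) by simp
  qed
  have "h u v = of_real \<mu> * ip u v" if v: "v \<in> U" for v
  proof (rule ccontr)
    define k where "k = h u v - of_real \<mu> * ip u v"
    assume "h u v \<noteq> of_real \<mu> * ip u v"
    hence k0: "(cmod k)\<^sup>2 > 0" by (simp add: k_def)
    define \<kappa> where "\<kappa> = Re (h v v) - \<mu> * Re (ip v v)"
    have pos: "0 \<le> 2 * s * (cmod k)\<^sup>2 + s\<^sup>2 * (cmod k)\<^sup>2 * \<kappa>" for s :: real
    proof -
      define c where "c = of_real s * k"
      let ?x = "u + (c *\<^sub>c v)"
      have "?x \<in> U" by (simp add: u(1) v U(1) cfun.subspace_scale cfun.subspace_add)
      hence "0 \<le> Re (h ?x ?x - of_real \<mu> * ip ?x ?x)" using ge[of ?x] by simp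
      also have "h ?x ?x - of_real \<mu> * ip ?x ?x =
          (h u u - of_real \<mu> * ip u u) + cnj c * k + c * (h v u - of_real \<mu> * ip v u)
          + c * cnj c * (h v v - of_real \<mu> * ip v v)"
        by (simp add: hD iD k_def algebra_simps)
      also have "h v u - of_real \<mu> * ip v u = cnj k"
        by (simp add: k_def hD iD)
      also have "h u u - of_real \<mu> * ip u u = 0"
        using herm_form_real[OF h, of u] u(2) by (simp add: \<mu>_def)
      also have "h v v - of_real \<mu> * ip v v = of_real \<kappa>"
        unfolding \<kappa>_def using herm_form_real[OF h, of v] herm_form_real[OF herm_form_ip, of v] by simp
      also have "0 + cnj c * k + c * cnj k + c * cnj c * of_real \<kappa> =
          of_real (2 * s * (cmod k)\<^sup>2 + s\<^sup>2 * (cmod k)\<^sup>2 * \<kappa>)"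
        unfolding c_def
        by (simp add: complex_norm_square power2_eq_square[of s] algebra_simps del: of_real_power)
      finally show ?thesis by simp
    qed
    \<comment> \<open>Negative, and with \<open>\<bar>s * \<kappa>\<bar> < 1\<close>, so the linear
      term outweighs the quadratic one.\<close>
    define s where "s = - 1 / (1 + \<bar>\<kappa>\<bar>)"
    have "s < 0" "2 + s * \<kappa> > 0"
      by (auto simp: s_def field_simps abs_if split: if_splits)
    hence "(s * (cmod k)\<^sup>2) * (2 + s * \<kappa>) < 0"
      using k0 by (intro mult_neg_pos) (auto simp: mult_neg_pos)
    thus False using pos[of s] by (simp add: algebra_simps power2_eq_square)
  qed
  thus ?thesis using u unfolding \<mu>_def by blast
qed

end

subsection \<open>Eigenvector bases and the min-max comparison\<close>

text \<open>The coordinates in \<open>K\<close> act as a dual basis: subtracting from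
  \<open>x\<close> the combination of the \<open>b k\<close> with coefficients \<open>x k\<close>
  leaves a vector of \<open>U\<close> that vanishes on \<open>K\<close>, hence 0. It serves to
  compute the dimensions of the domains of the forms.\<close>

lemma coordinate_basis:
  assumes K: "finite K" and U: "cfun.subspace U" and b: "\<And>k. k \<in> K \<Longrightarrow> b k \<in> U"
    and bc: "\<And>j k. j \<in> K \<Longrightarrow> k \<in> K \<Longrightarrow> b k j = (if j = k then 1 else 0)"
    and sep: "\<And>x. x \<in> U \<Longrightarrow> (\<And>k. k \<in> K \<Longrightarrow> x k = 0) \<Longrightarrow> x = 0"
  shows "U \<subseteq> cfun.span (b ` K)" "cfun.dim U = card K"
proof -
  have inj: "inj_on b K"
    by (rule inj_onI) (metis bc one_neq_zero)
  have coord: "(\<Sum>k\<in>K. c k *\<^sub>c b k) j = c j" if "j \<in> K" for c j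
  proof -
    have "(\<Sum>k\<in>K. c k *\<^sub>c b k) j = (\<Sum>k\<in>K. if j = k then c k else 0)"
      unfolding fun_sum_apply by (rule sum.cong) (auto simp: cscale_apply bc that)
    thus ?thesis using K that by simp
  qed
  show span: "U \<subseteq> cfun.span (b ` K)"
  proof
    fix x assume x: "x \<in> U"
    let ?s = "\<Sum>k\<in>K. x k *\<^sub>c b k"
    have "?s \<in> U" by (intro cfun.subspace_sum U cfun.subspace_scale b)
    hence "x - ?s = 0"
      by (intro sep) (auto simp: U x cfun.subspace_diff minus_apply coord)
    hence "x = ?s" by (rule iffD1[OF right_minus_eq])
    also have "\<dots> \<in> cfun.span (b ` K)"
      by (intro cfun.span_sum cfun.span_scale cfun.span_base imageI)
    finally show "x \<in> cfun.span (b ` K)" .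
  qed
  have "cfun.independent (b ` K)"
  proof
    assume "cfun.dependent (b ` K)"
    then obtain c k where c: "k \<in> K" "c (b k) \<noteq> 0" "(\<Sum>v\<in>b ` K. c v *\<^sub>c v) = 0"
      using cfun.dependent_finite[of "b ` K"] K by auto
    have "(\<Sum>v\<in>b ` K. c v *\<^sub>c v) = (\<Sum>k\<in>K. c (b k) *\<^sub>c b k)"
      using inj by (simp add: sum.reindex)
    with c(3) coord[OF c(1), of "\<lambda>k. c (b k)"] c(2) show False by (simp add: zero_fun_apply)
  qed
  moreover have "b ` K \<subseteq> U" using b by auto
  ultimately show "cfun.dim U = card K"
    using cfun.basis_card_eq_dim[of "b ` K" U] span inj by (simp add: card_image)
qed

lemma subspace_supported: "cfun.subspace (supported N)"
  unfolding supported_def by (rule cfun.subspaceI) (auto simp: seq_apply)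

lemma supported_unit:
  shows "supported N \<subseteq> cfun.span (unit_seq ` {1..N})" "cfun.dim (supported N) = N"
proof -
  have "supported N \<subseteq> cfun.span (unit_seq ` {1..N}) \<and> cfun.dim (supported N) = card {1..N}"
    by (rule conjI; rule coordinate_basis)
      (auto simp: subspace_supported, auto simp: supported_def unit_seq_def fun_eq_iff zero_fun_apply)
  thus "supported N \<subseteq> cfun.span (unit_seq ` {1..N})" "cfun.dim (supported N) = N" by auto
qed

text \<open>Gaussian elimination, one equation per induction step. Rows and unknowns are indexed by
  arbitrary sets so that the rows can later be functionals and the unknowns the coefficients of
  eigenvectors.\<close>

lemma underdetermined_system:
  fixes a :: "'r \<Rightarrow> 's \<Rightarrow> complex"
  assumes "finite R" "finite S" "card R < card S"
  shows "\<exists>c. (\<exists>s\<in>S. c s \<noteq> 0) \<and> (\<forall>r\<in>R. (\<Sum>s\<in>S. c s * a r s) = 0)"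
  using assms
proof (induction R arbitrary: S a rule: finite_induct)
  case empty
  thus ?case by (intro exI[of _ "\<lambda>_. 1"]) (auto simp: card_gt_0_iff)
next
  case (insert p R)
  show ?case
  proof (cases "\<forall>s\<in>S. a p s = 0")
    case True
    have "card R < card S" using insert by simp
    from insert.IH[OF insert.prems(1) this, of a] True show ?thesis by auto
  next
    case False
    then obtain s0 where s0: "s0 \<in> S" "a p s0 \<noteq> 0" by blast
    define S' where "S' = S - {s0}"
    have S': "finite S'" "card R < card S'" "S = insert s0 S'" "s0 \<notin> S'"
      using insert s0 by (auto simp: S'_def)
    obtain c where c: "\<exists>s\<in>S'. c s \<noteq> 0"
      "\<And>r. r \<in> R \<Longrightarrow> (\<Sum>s\<in>S'. c s * (a r s - a r s0 * a p s / a p s0)) = 0"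
      using insert.IH[OF S'(1,2), of "\<lambda>r s. a r s - a r s0 * a p s / a p s0"] by auto
    \<comment> \<open>The pivot unknown is solved from equation \<open>p\<close>; substituted into
      any other row, it turns that row into the reduced one already satisfied by
      \<open>c\<close>.\<close>
    define d where "d = c(s0 := - (\<Sum>s\<in>S'. c s * a p s) / a p s0)"
    have d: "(\<Sum>s\<in>S. d s * a r s) =
        (\<Sum>s\<in>S'. c s * a r s) - (\<Sum>s\<in>S'. c s * a p s) / a p s0 * a r s0" for r
    proof -
      have "(\<Sum>s\<in>S'. d s * a r s) = (\<Sum>s\<in>S'. c s * a r s)"
        using S'(4) by (intro sum.cong) (auto simp: d_def)
      thus ?thesis using S' by (simp add: d_def)
    qed
    show ?thesis
    proof (intro exI[of _ d] conjI ballI)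
      show "\<exists>s\<in>S. d s \<noteq> 0" using c(1) S' by (auto simp: d_def)
      fix r assume r: "r \<in> insert p R"
      show "(\<Sum>s\<in>S. d s * a r s) = 0"
      proof (cases "r = p")
        case True
        thus ?thesis unfolding d using s0(2) by simp
      next
        case False
        have "(\<Sum>s\<in>S'. c s * (a r s - a r s0 * a p s / a p s0)) =
            (\<Sum>s\<in>S'. c s * a r s) - (\<Sum>s\<in>S'. c s * a p s) / a p s0 * a r s0"
          by (simp add: right_diff_distrib sum_subtractf sum_divide_distrib sum_distrib_left
              sum_distrib_right mult_ac)
        thus ?thesis unfolding d using c(2)[of r] r False by auto
      qed
    qed
  qed
qed

context weighted
begin

text \<open>Testing against \<open>U\<close> only makes this an eigenvector of the compression of
  \<open>h\<close> to \<open>U\<close>. For vectors of norm 1 the eigenvalue has to be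
  \<open>Re (h u u)\<close>, so it is not carried separately.\<close>

definition eigvec :: "((nat \<Rightarrow> complex) \<Rightarrow> (nat \<Rightarrow> complex) \<Rightarrow> complex) \<Rightarrow> (nat \<Rightarrow> complex) set
    \<Rightarrow> (nat \<Rightarrow> complex) \<Rightarrow> bool" where
  "eigvec h U u \<longleftrightarrow> u \<in> U \<and> (\<forall>v\<in>U. h u v = of_real (Re (h u u)) * ip u v)"

lemma eigvecD:
  assumes "eigvec h U u"
  shows "u \<in> U" and "v \<in> U \<Longrightarrow> h u v = of_real (Re (h u u)) * ip u v"
  using assms unfolding eigvec_def by blast+

definition orthonormal :: "(nat \<Rightarrow> complex) set \<Rightarrow> bool" where
  "orthonormal B \<longleftrightarrow> (\<forall>u\<in>B. \<forall>v\<in>B. ip u v = (if u = v then 1 else 0))"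

lemma ip_orthonormal_sum:
  assumes "finite B" "orthonormal B" "v \<in> B"
  shows "ip (\<Sum>u\<in>B. c u *\<^sub>c u) v = c v"
proof -
  have "ip (\<Sum>u\<in>B. c u *\<^sub>c u) v = (\<Sum>u\<in>B. if u = v then c u else 0)"
    unfolding herm_form_sum[OF herm_form_ip]
    by (rule sum.cong) (use assms in \<open>auto simp: orthonormal_def\<close>)
  thus ?thesis using assms by simp
qed

lemma orthonormal_independent:
  assumes "finite B" "orthonormal B"
  shows "cfun.independent B"
proof
  assume "cfun.dependent B"
  then obtain c v where c: "v \<in> B" "c v \<noteq> 0" "(\<Sum>v\<in>B. c v *\<^sub>c v) = 0"
    using cfun.dependent_finite[of B] assms by auto
  with ip_orthonormal_sum[OF assms c(1), of c] herm_formD(2)[OF herm_form_ip, of 0 0 v]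
  show False by simp
qed

lemma subspace_orthogonal:
  assumes "cfun.subspace U"
  shows "cfun.subspace {x\<in>U. \<forall>u\<in>B. ip x u = 0}"
  using assms herm_formD(2)[OF herm_form_ip, of 0 0]
  by (auto simp: cfun.subspace_def herm_formD[OF herm_form_ip])

lemma closed_orthogonal:
  assumes "closed U"
  shows "closed {x\<in>U. \<forall>u\<in>B. ip x u = 0}"
proof -
  have "continuous_on UNIV (\<lambda>x. ip x u)" for u
    unfolding ip_def
    by (intro continuous_on_sum continuous_on_mult continuous_on_const continuous_coord)
  hence "closed {x. ip x u = 0}" for u
    by (rule closed_Collect_eq) (rule continuous_on_const)
  moreover have "{x\<in>U. \<forall>u\<in>B. ip x u = 0} = U \<inter> (\<Inter>u\<in>B. {x. ip x u = 0})" by auto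
  ultimately show ?thesis using assms by (simp add: closed_INT closed_Int)
qed

text \<open>A maximal orthonormal set of eigenvectors spans: otherwise its orthogonal complement in U,
  which h leaves invariant, contains a further eigenvector.\<close>
lemma eigenvector_basis_exists:
  assumes h: "herm_form h" and U: "cfun.subspace U" "closed U" "U \<subseteq> supported N"
  shows "\<exists>B. finite B \<and> orthonormal B \<and> (\<forall>u\<in>B. eigvec h U u) \<and>
    (\<forall>x\<in>U. x = (\<Sum>u\<in>B. ip x u *\<^sub>c u))"
proof -
  note hD = herm_formD[OF h] and iD = herm_formD[OF herm_form_ip]
  define P where "P B \<longleftrightarrow> finite B \<and> orthonormal B \<and> (\<forall>u\<in>B. eigvec h U u)" for B
  have bound: "card B \<le> N" if "P B" for B
  proof -
    have "B \<subseteq> supported N" using that U(3) by (auto simp: P_def eigvec_def)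
    hence "B \<subseteq> cfun.span (unit_seq ` {1..N})" using supported_unit(1) by blast
    moreover have "cfun.independent B" using that orthonormal_independent unfolding P_def by blast
    ultimately have "card B \<le> card (unit_seq ` {1..N})"
      using cfun.independent_span_bound[of "unit_seq ` {1..N}" B] by simp
    also have "\<dots> \<le> N" using card_image_le[of "{1..N}" unit_seq] by simp
    finally show ?thesis .
  qed
  have "P {}" by (simp add: P_def orthonormal_def)
  moreover have "\<forall>C. P C \<longrightarrow> card C < Suc N" using bound by (simp add: less_Suc_eq_le)
  ultimately have "\<exists>B. P B \<and> (\<forall>C. P C \<longrightarrow> card C \<le> card B)"
    by (rule ex_has_greatest_nat)
  then obtain B where B: "P B" and max: "\<And>C. P C \<Longrightarrow> card C \<le> card B"
    by (elim exE conjE) simp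
  have fin: "finite B" and on: "orthonormal B" and ev: "\<And>u. u \<in> B \<Longrightarrow> eigvec h U u"
    using B by (auto simp: P_def)
  define U' where "U' = {x\<in>U. \<forall>u\<in>B. ip x u = 0}"
  have BU: "B \<subseteq> U" using ev by (auto simp: eigvec_def)
  have split: "x - (\<Sum>u\<in>B. ip x u *\<^sub>c u) \<in> U'" if x: "x \<in> U" for x
  proof -
    have "ip (x - s) v = ip x v - ip s v" for s v
      using iD(1)[of "x - s" s v] by simp
    moreover have "x - (\<Sum>u\<in>B. ip x u *\<^sub>c u) \<in> U"
      by (intro cfun.subspace_diff cfun.subspace_sum cfun.subspace_scale U(1) x subsetD[OF BU])
    ultimately show ?thesis
      by (simp add: U'_def ip_orthonormal_sum[OF fin on])
  qed
  have "U' = {0}"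
  proof (rule ccontr)
    assume "U' \<noteq> {0}"
    moreover have "cfun.subspace U'" "closed U'" "U' \<subseteq> supported N"
      using U by (auto simp: U'_def intro: subspace_orthogonal closed_orthogonal)
    ultimately obtain u where u: "u \<in> U'" "ip u u = 1"
      "\<And>v. v \<in> U' \<Longrightarrow> h u v = of_real (Re (h u u)) * ip u v"
      using eigenvector_exists[OF h, of U'] by (auto simp del: of_real_Re)
    have uU: "u \<in> U" and ub: "\<And>b. b \<in> B \<Longrightarrow> ip u b = 0" using u(1) by (auto simp: U'_def)
    have bu: "ip b u = 0" if "b \<in> B" for b using ub[OF that] iD(5)[of u b] by simp
    have hub: "h u b = 0" if "b \<in> B" for b
    proof -
      have "h b u = 0" by (subst eigvecD(2)[OF ev[OF that] uU]) (simp add: bu[OF that])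
      thus ?thesis using hD(5)[of b u] by simp
    qed
    have "h u v = of_real (Re (h u u)) * ip u v" if v: "v \<in> U" for v
    proof -
      define s where "s = (\<Sum>b\<in>B. ip v b *\<^sub>c b)"
      have "h u s = 0" "ip u s = 0"
        by (simp_all add: s_def herm_form_sum_right[OF h] herm_form_sum_right[OF herm_form_ip] hub ub)
      moreover have "v = (v - s) + s" by simp
      ultimately have "h u v = h u (v - s)" "ip u v = ip u (v - s)"
        using hD(3)[of u "v - s" s] iD(3)[of u "v - s" s] by simp_all
      thus ?thesis using u(3)[OF split[OF v]] by (simp add: s_def)
    qed
    hence "eigvec h U u" using uU unfolding eigvec_def by blast
    moreover have "orthonormal (insert u B)"
      using on u(2) ub bu unfolding orthonormal_def by auto
    ultimately have "P (insert u B)"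
      using fin ev unfolding P_def by blast
    moreover have "u \<notin> B" using ub[of u] u(2) by auto
    ultimately show False using max[of "insert u B"] fin by simp
  qed
  have "x = (\<Sum>u\<in>B. ip x u *\<^sub>c u)" if "x \<in> U" for x
  proof -
    have "x - (\<Sum>u\<in>B. ip x u *\<^sub>c u) = 0"
      using split[OF that] \<open>U' = {0}\<close> by blast
    thus ?thesis by (rule iffD1[OF right_minus_eq])
  qed
  thus ?thesis by (intro exI[of _ B] conjI ballI fin on ev)
qed

text \<open>A sorted list instead of a set: position \<open>n\<close> then carries the
  \<open>n\<close>-th eigenvalue, repeated according to multiplicity.\<close>

definition eigbasis :: "((nat \<Rightarrow> complex) \<Rightarrow> (nat \<Rightarrow> complex) \<Rightarrow> complex) \<Rightarrow> (nat \<Rightarrow> complex) set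
    \<Rightarrow> (nat \<Rightarrow> complex) list \<Rightarrow> bool" where
  "eigbasis h U us \<longleftrightarrow> distinct us \<and> orthonormal (set us) \<and> (\<forall>u\<in>set us. eigvec h U u) \<and>
     (\<forall>x\<in>U. x = (\<Sum>u\<in>set us. ip x u *\<^sub>c u)) \<and> sorted (map (\<lambda>u. Re (h u u)) us)"

lemma eigbasis_expand:
  assumes "eigbasis h U us" "x \<in> U"
  shows "x = (\<Sum>u\<in>set us. ip x u *\<^sub>c u)"
proof -
  have "\<forall>x\<in>U. x = (\<Sum>u\<in>set us. ip x u *\<^sub>c u)"
    using assms(1) unfolding eigbasis_def by (elim conjE)
  thus ?thesis using assms(2) by (rule bspec)
qed

lemma eigbasis_exists:
  assumes "herm_form h" "cfun.subspace U" "closed U" "U \<subseteq> supported N"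
  obtains us where "eigbasis h U us"
proof -
  obtain B where B: "finite B" "orthonormal B" "\<forall>u\<in>B. eigvec h U u"
    "\<forall>x\<in>U. x = (\<Sum>u\<in>B. ip x u *\<^sub>c u)"
    using eigenvector_basis_exists[OF assms] by (elim exE conjE)
  obtain bs where bs: "set bs = B" "distinct bs" using B(1) finite_distinct_list by blast
  define us where "us = sort_key (\<lambda>u. Re (h u u)) bs"
  have us: "set us = B" "distinct us" "sorted (map (\<lambda>u. Re (h u u)) us)"
    using bs by (simp_all add: us_def)
  have "eigbasis h U us"
    unfolding eigbasis_def us(1) by (intro conjI us(2,3) B(2-4))
  thus ?thesis by (rule that)
qed

lemma eigbasis_basis:
  assumes "eigbasis h U us"
  shows "set us \<subseteq> U" "cfun.independent (set us)" "U \<subseteq> cfun.span (set us)" "cfun.dim U = length us"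
proof -
  show 1: "set us \<subseteq> U" using assms by (auto simp: eigbasis_def eigvec_def)
  show 2: "cfun.independent (set us)"
    using assms orthonormal_independent[of "set us"] unfolding eigbasis_def by blast
  show 3: "U \<subseteq> cfun.span (set us)"
  proof
    fix x assume "x \<in> U"
    hence "x = (\<Sum>u\<in>set us. ip x u *\<^sub>c u)" by (rule eigbasis_expand[OF assms])
    also have "\<dots> \<in> cfun.span (set us)"
      by (intro cfun.span_sum cfun.span_scale cfun.span_base)
    finally show "x \<in> cfun.span (set us)" .
  qed
  show "cfun.dim U = length us"
    using cfun.basis_card_eq_dim[OF 1 3 2] assms by (simp add: eigbasis_def distinct_card)
qed

text \<open>Both forms are diagonal in the basis. The coefficients are arbitrary because the lemma
  is applied to Fourier coefficients as well as to a combination obtained from a linear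
  system.\<close>

lemma eigbasis_form:
  assumes h: "herm_form h" and us: "eigbasis h U us" and x: "x = (\<Sum>u\<in>set us. c u *\<^sub>c u)"
  shows "Re (h x x) = (\<Sum>u\<in>set us. (cmod (c u))\<^sup>2 * Re (h u u))"
    "Re (ip x x) = (\<Sum>u\<in>set us. (cmod (c u))\<^sup>2)"
proof -
  have on: "orthonormal (set us)" using us by (simp add: eigbasis_def)
  have hx: "h x u = c u * of_real (Re (h u u))" if u: "u \<in> set us" for u
  proof -
    have "h x u = (\<Sum>v\<in>set us. if v = u then c u * of_real (Re (h u u)) else 0)"
      unfolding x herm_form_sum[OF h]
    proof (rule sum.cong[OF refl])
      fix v assume v: "v \<in> set us"
      have "h v u = of_real (Re (h v v)) * ip v u"
        using us u v eigvecD unfolding eigbasis_def by blast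
      moreover have "ip v u = (if v = u then 1 else 0)"
        using on u v by (simp add: orthonormal_def)
      ultimately show "c v * h v u = (if v = u then c u * of_real (Re (h u u)) else 0)"
        by (simp split: if_splits)
    qed
    thus ?thesis using u by simp
  qed
  have ix: "ip x u = c u" if u: "u \<in> set us" for u
    unfolding x using ip_orthonormal_sum[OF _ on u] by simp
  have "h x x = (\<Sum>u\<in>set us. cnj (c u) * h x u)"
    by (subst (2) x) (rule herm_form_sum_right[OF h])
  also have "\<dots> = (\<Sum>u\<in>set us. of_real ((cmod (c u))\<^sup>2 * Re (h u u)))"
    by (rule sum.cong) (simp_all add: hx complex_norm_square mult_ac del: of_real_power)
  finally show "Re (h x x) = (\<Sum>u\<in>set us. (cmod (c u))\<^sup>2 * Re (h u u))" by simp
  have "ip x x = (\<Sum>u\<in>set us. cnj (c u) * ip x u)"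
    by (subst (2) x) (rule herm_form_sum_right[OF herm_form_ip])
  also have "\<dots> = (\<Sum>u\<in>set us. of_real ((cmod (c u))\<^sup>2))"
    by (rule sum.cong) (simp_all add: ix complex_norm_square mult_ac del: of_real_power)
  finally show "Re (ip x x) = (\<Sum>u\<in>set us. (cmod (c u))\<^sup>2)" by simp
qed

text \<open>Courant--Fischer: fewer linear conditions than unknowns leave a nonzero vector in the span of
  the first j + 1 eigenvectors of the second form that lies in the domain of the first form and
  is orthogonal to the first i eigenvectors of the latter.\<close>
lemma eigenvalue_compare:
  assumes h1: "herm_form h1" and us: "eigbasis h1 U1 us"
    and h2: "herm_form h2" and vs: "eigbasis h2 U2 vs" and U2: "cfun.subspace U2"
    and i: "i < length us" and j: "j < length vs"
    and \<Phi>: "finite \<Phi>" "card \<Phi> + i \<le> j"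
    and lin: "\<And>\<phi> A c. \<phi> \<in> \<Phi> \<Longrightarrow> \<phi> (\<Sum>u\<in>A. c u *\<^sub>c u) = (\<Sum>u\<in>A. c u * \<phi> u)"
    and le: "\<And>x. x \<in> U2 \<Longrightarrow> (\<And>\<phi>. \<phi> \<in> \<Phi> \<Longrightarrow> \<phi> x = 0) \<Longrightarrow> x \<in> U1 \<and> Re (h1 x x) \<le> Re (h2 x x)"
  shows "Re (h1 (us ! i) (us ! i)) \<le> Re (h2 (vs ! j) (vs ! j))"
proof -
  define R where "R = \<Phi> \<union> (\<lambda>u x. ip x u) ` set (take i us)"
  define S where "S = set (take (Suc j) vs)"
  have dist: "distinct us" "distinct vs" using us vs by (auto simp: eigbasis_def)
  have "card R \<le> card \<Phi> + card ((\<lambda>u x. ip x u) ` set (take i us))"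
    unfolding R_def by (rule card_Un_le)
  also have "card ((\<lambda>u x. ip x u) ` set (take i us)) \<le> i"
    using card_image_le[of "set (take i us)" "\<lambda>u x. ip x u"] card_length[of "take i us"] by simp
  finally have "card R \<le> j" using \<Phi>(2) by simp
  moreover have "card S = Suc j"
    unfolding S_def using dist(2) j by (simp add: distinct_card)
  ultimately have "card R < card S" by simp
  moreover have "finite R" "finite S" using \<Phi>(1) by (auto simp: R_def S_def)
  ultimately obtain c where c: "\<exists>s\<in>S. c s \<noteq> 0" "\<And>r. r \<in> R \<Longrightarrow> (\<Sum>s\<in>S. c s * r s) = 0"
    using underdetermined_system[of R S "\<lambda>r s. r s"] by auto
  define x where "x = (\<Sum>s\<in>S. c s *\<^sub>c s)"
  define c' where "c' s = (if s \<in> S then c s else 0)" for s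
  have SV: "S \<subseteq> set vs" unfolding S_def by (rule set_take_subset)
  have x': "x = (\<Sum>s\<in>set vs. c' s *\<^sub>c s)"
    unfolding x_def by (rule sum.mono_neutral_cong_left) (use SV in \<open>auto simp: c'_def\<close>)
  have "x \<in> U2"
    unfolding x_def using SV eigbasis_basis(1)[OF vs]
    by (intro cfun.subspace_sum cfun.subspace_scale U2) auto
  moreover have "\<phi> x = 0" if "\<phi> \<in> \<Phi>" for \<phi>
    using c(2)[of \<phi>] that by (simp add: x_def lin R_def)
  ultimately have xU1: "x \<in> U1" and hle: "Re (h1 x x) \<le> Re (h2 x x)" using le by blast+
  have orth: "ip x u = 0" if "u \<in> set (take i us)" for u
    using c(2)[of "\<lambda>x. ip x u"] that by (simp add: x_def herm_form_sum[OF herm_form_ip] R_def)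
  note xu = eigbasis_expand[OF us xU1]
  note F1 = eigbasis_form[OF h1 us xu] and F2 = eigbasis_form[OF h2 vs x']
  have srt: "sorted (map (\<lambda>u. Re (h1 u u)) us)" "sorted (map (\<lambda>u. Re (h2 u u)) vs)"
    using us vs by (auto simp: eigbasis_def)
  have pos: "Re (ip x x) > 0"
  proof -
    obtain s where "s \<in> S" "c s \<noteq> 0" using c(1) by blast
    thus ?thesis unfolding F2(2) using SV by (intro sum_pos2[of _ s]) (auto simp: c'_def)
  qed
  \<comment> \<open>The vector \<open>x\<close> has components only at positions at least
    \<open>i\<close> in \<open>us\<close> and at most \<open>j\<close> in \<open>vs\<close>; as both
    lists are sorted, this bounds its first Rayleigh quotient from below and its second from
    above.\<close>
  have "Re (h1 (us ! i) (us ! i)) * Re (ip x x) \<le> Re (h1 x x)"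
    unfolding F1 sum_distrib_left
  proof (rule sum_mono)
    fix u assume "u \<in> set us"
    then obtain k where k: "k < length us" "u = us ! k" by (metis in_set_conv_nth)
    show "Re (h1 (us ! i) (us ! i)) * (cmod (ip x u))\<^sup>2 \<le> (cmod (ip x u))\<^sup>2 * Re (h1 u u)"
    proof (cases "k < i")
      case True
      hence "u \<in> set (take i us)" using k by (auto simp: in_set_conv_nth intro!: exI[of _ k])
      thus ?thesis using orth by simp
    next
      case False
      hence "Re (h1 (us ! i) (us ! i)) \<le> Re (h1 u u)"
        using sorted_nth_mono[OF srt(1), of i k] k i by simp
      thus ?thesis by (simp add: mult.commute mult_right_mono)
    qed
  qed
  also note hle
  also have "Re (h2 x x) \<le> Re (h2 (vs ! j) (vs ! j)) * Re (ip x x)"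
    unfolding F2 sum_distrib_left
  proof (rule sum_mono)
    fix v assume "v \<in> set vs"
    show "(cmod (c' v))\<^sup>2 * Re (h2 v v) \<le> Re (h2 (vs ! j) (vs ! j)) * (cmod (c' v))\<^sup>2"
    proof (cases "v \<in> S")
      case True
      then obtain k where k: "k < length vs" "k \<le> j" "v = vs ! k"
        unfolding S_def by (auto simp: in_set_conv_nth)
      hence "Re (h2 v v) \<le> Re (h2 (vs ! j) (vs ! j))"
        using sorted_nth_mono[OF srt(2), of k j] j by simp
      thus ?thesis by (simp add: mult.commute[of "Re _"] mult_left_mono)
    qed (simp add: c'_def)
  qed
  finally show ?thesis using pos by simp
qed

definition eigspace :: "((nat \<Rightarrow> complex) \<Rightarrow> (nat \<Rightarrow> complex) \<Rightarrow> complex) \<Rightarrow> (nat \<Rightarrow> complex) set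
    \<Rightarrow> complex \<Rightarrow> (nat \<Rightarrow> complex) set" where
  "eigspace h U lam = {x\<in>U. \<forall>v\<in>U. h x v = lam * ip x v}"

text \<open>Evaluating \<open>h x u\<close> from both sides gives
  \<open>(lam - Re (h u u)) * ip x u = 0\<close>, so only basis vectors with eigenvalue
  \<open>lam\<close> contribute to \<open>x\<close>. For non-real \<open>lam\<close> there are none,
  which is the reality of the spectrum.\<close>

lemma dim_eigspace:
  assumes h: "herm_form h" and us: "eigbasis h U us" and U: "cfun.subspace U"
  shows "cfun.dim (eigspace h U lam) = card {u\<in>set us. of_real (Re (h u u)) = lam}"
proof -
  note hD = herm_formD[OF h] and iD = herm_formD[OF herm_form_ip]
  let ?B = "{u\<in>set us. of_real (Re (h u u)) = lam}"
  have sub: "?B \<subseteq> eigspace h U lam"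
    using us eigvecD unfolding eigspace_def eigbasis_def by blast
  have "eigspace h U lam \<subseteq> cfun.span ?B"
  proof
    fix x assume x: "x \<in> eigspace h U lam"
    have "ip x u = 0" if u: "u \<in> set us" "of_real (Re (h u u)) \<noteq> lam" for u
    proof -
      have "u \<in> U" "h u x = of_real (Re (h u u)) * ip u x"
        using us u(1) x eigvecD unfolding eigbasis_def eigspace_def by blast+
      hence "lam * ip x u = cnj (of_real (Re (h u u)) * ip u x)"
        using x hD(5)[of u x] by (auto simp: eigspace_def)
      also have "\<dots> = of_real (Re (h u u)) * ip x u" by (simp add: iD)
      finally show ?thesis using u(2) by auto
    qed
    hence "(\<Sum>u\<in>set us. ip x u *\<^sub>c u) = (\<Sum>u\<in>?B. ip x u *\<^sub>c u)"
      by (intro sum.mono_neutral_right) auto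
    moreover have "x = (\<Sum>u\<in>set us. ip x u *\<^sub>c u)"
      by (rule eigbasis_expand[OF us]) (use x in \<open>simp add: eigspace_def\<close>)
    ultimately have "x = (\<Sum>u\<in>?B. ip x u *\<^sub>c u)" by (rule trans[rotated])
    also have "\<dots> \<in> cfun.span ?B"
      by (intro cfun.span_sum cfun.span_scale cfun.span_base)
    finally show "x \<in> cfun.span ?B" .
  qed
  moreover have "cfun.independent ?B"
    by (rule cfun.independent_mono[OF eigbasis_basis(2)[OF us]]) auto
  ultimately show ?thesis using cfun.basis_card_eq_dim[OF sub] by simp
qed

end

subsection \<open>Weak form of the difference equation\<close>

interpretation cfun_pair: vector_space_pair cscale cscale ..

lemma dim_injective_image:
  assumes lin: "Vector_Spaces.linear cscale cscale g" and inj: "inj_on g S" and S: "cfun.subspace S"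
  shows "cfun.dim (g ` S) = cfun.dim S"
proof -
  obtain B where B: "B \<subseteq> S" "cfun.independent B" "S \<subseteq> cfun.span B" "card B = cfun.dim S"
    by (rule cfun.basis_exists)
  have sp: "cfun.span B = S" using B(1,3) S by (simp add: cfun.span_subspace)
  have "cfun.independent (g ` B)"
    by (rule cfun_pair.linear_independent_injective_image[OF lin B(2)]) (simp add: sp inj)
  moreover have "g ` S \<subseteq> cfun.span (g ` B)"
    using cfun_pair.linear_span_image[OF lin, of B] sp by simp
  ultimately have "card (g ` B) = cfun.dim (g ` S)"
    using B(1) by (intro cfun.basis_card_eq_dim) auto
  thus ?thesis using B(1,4) inj by (metis card_image inj_on_subset)
qed

text \<open>The forms below are sums of such terms, with \<open>l\<close> a coordinate, a difference
  of coordinates or \<open>ell\<close>; their definitions keep this bracketing so that the rule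
  matches.\<close>

lemma herm_form_rank1:
  assumes "\<And>x y. l (x + y) = l x + l y" "\<And>c x. l (c *\<^sub>c x) = c * l x" "continuous_on UNIV l"
  shows "herm_form (\<lambda>x v. of_real r * (l x * cnj (l v)))"
proof -
  have "continuous_on UNIV (\<lambda>x. of_real r * (l x * cnj (l x)))"
    by (intro continuous_on_mult continuous_on_const continuous_on_cnj assms(3))
  thus ?thesis unfolding herm_form_def by (simp add: assms(1,2) algebra_simps)
qed

lemma herm_form_add:
  assumes "herm_form g" "herm_form h"
  shows "herm_form (\<lambda>x v. g x v + h x v)"
proof -
  have "continuous_on UNIV (\<lambda>x. g x x + h x x)"
    by (rule continuous_on_add[OF herm_formD(6)[OF assms(1)] herm_formD(6)[OF assms(2)]])
  thus ?thesis
    unfolding herm_form_def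
    by (simp add: herm_formD(1,2,5)[OF assms(1)] herm_formD(1,2,5)[OF assms(2)] algebra_simps)
qed

lemma herm_form_zero: "herm_form (\<lambda>x v. 0)"
  unfolding herm_form_def by simp

lemma herm_form_sum_forms:
  assumes "\<And>i. i \<in> A \<Longrightarrow> herm_form (h i)"
  shows "herm_form (\<lambda>x v. \<Sum>i\<in>A. h i x v)"
  using assms
proof (induction A rule: infinite_finite_induct)
  case (insert i A)
  thus ?case by (simp add: herm_form_add)
qed (simp_all add: herm_form_zero)

definition restr :: "nat \<Rightarrow> (nat \<Rightarrow> complex) \<Rightarrow> nat \<Rightarrow> complex" where
  "restr N y = (\<lambda>n. if n \<in> {1..N} then y n else 0)"

definition sl_op :: "(nat \<Rightarrow> real) \<Rightarrow> (nat \<Rightarrow> real) \<Rightarrow> (nat \<Rightarrow> complex) \<Rightarrow> nat \<Rightarrow> complex" where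
  "sl_op f q y n = - (of_real (f n) * (y (n+1) - y n) - of_real (f (n-1)) * (y n - y (n-1)))
     + of_real (q n) * y n"

lemma sl_op_linear:
  "sl_op f q (x + y) n = sl_op f q x n + sl_op f q y n"
  "sl_op f q (c *\<^sub>c x) n = c * sl_op f q x n"
  by (simp_all add: sl_op_def seq_apply algebra_simps)

lemma sl_eq_iff: "sl_eq N f q w lam y \<longleftrightarrow> (\<forall>n\<in>{1..N}. sl_op f q y n = lam * of_real (w n) * y n)"
  by (simp add: sl_eq_def sl_op_def)

lemma subspace_sol_space: "cfun.subspace (sol_space N f q w M lam)"
proof (rule cfun.subspaceI)
  show "0 \<in> sol_space N f q w M lam"
    by (simp add: sol_space_def sl_eq_def bc_holds_def zero_fun_apply)
next
  fix x y assume x: "x \<in> sol_space N f q w M lam" and y: "y \<in> sol_space N f q w M lam"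
  have "bc_holds N f M (x + y)"
    unfolding bc_holds_def
  proof (intro allI impI)
    fix i :: nat assume "i < 2"
    hence "(M i 0 * x 0 + M i 1 * (of_real (f 0) * (x 1 - x 0))
            + M i 2 * x N + M i 3 * (of_real (f N) * (x (N+1) - x N))) +
           (M i 0 * y 0 + M i 1 * (of_real (f 0) * (y 1 - y 0))
            + M i 2 * y N + M i 3 * (of_real (f N) * (y (N+1) - y N))) = 0"
      using x y by (simp add: sol_space_def bc_holds_def)
    thus "M i 0 * (x + y) 0 + M i 1 * (of_real (f 0) * ((x + y) 1 - (x + y) 0))
            + M i 2 * (x + y) N + M i 3 * (of_real (f N) * ((x + y) (N+1) - (x + y) N)) = 0"
      by (simp add: seq_apply algebra_simps)
  qed
  thus "x + y \<in> sol_space N f q w M lam"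
    using x y by (auto simp: sol_space_def sl_eq_iff sl_op_linear seq_apply algebra_simps)
next
  fix c x assume x: "x \<in> sol_space N f q w M lam"
  have "bc_holds N f M (c *\<^sub>c x)"
    unfolding bc_holds_def
  proof (intro allI impI)
    fix i :: nat assume "i < 2"
    hence "c * (M i 0 * x 0 + M i 1 * (of_real (f 0) * (x 1 - x 0))
            + M i 2 * x N + M i 3 * (of_real (f N) * (x (N+1) - x N))) = 0"
      using x by (simp add: sol_space_def bc_holds_def)
    thus "M i 0 * (c *\<^sub>c x) 0 + M i 1 * (of_real (f 0) * ((c *\<^sub>c x) 1 - (c *\<^sub>c x) 0))
            + M i 2 * (c *\<^sub>c x) N + M i 3 * (of_real (f N) * ((c *\<^sub>c x) (N+1) - (c *\<^sub>c x) N)) = 0"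
      by (simp add: seq_apply algebra_simps)
  qed
  thus "c *\<^sub>c x \<in> sol_space N f q w M lam"
    using x by (auto simp: sol_space_def sl_eq_iff sl_op_linear seq_apply algebra_simps)
qed

lemma summation_by_parts:
  fixes F c :: "nat \<Rightarrow> complex"
  shows "(\<Sum>n=1..N. (F (n-1) - F n) * c n) =
    (\<Sum>n=1..N. F (n-1) * (c n - c (n-1))) - F N * c N + F 0 * c 0"
  by (induction N) (auto simp: algebra_simps)

text \<open>The energy for the boundary conditions \<open>y 0 = 0\<close> and
  \<open>f N * (y (N+1) - y N) = 0\<close>: on sequences supported on 1..N the summand
  \<open>n = 1\<close> involves \<open>x 1\<close> alone, and \<open>f N\<close> does not occur. The
  other problems perturb or restrict it.\<close>

definition base_form :: "nat \<Rightarrow> (nat \<Rightarrow> real) \<Rightarrow> (nat \<Rightarrow> real) \<Rightarrow> (nat \<Rightarrow> complex)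
    \<Rightarrow> (nat \<Rightarrow> complex) \<Rightarrow> complex" where
  "base_form N f q x v =
     (\<Sum>n=1..N. of_real (f (n-1)) * ((x n - x (n-1)) * cnj (v n - v (n-1))))
     + (\<Sum>n=1..N. of_real (q n) * (x n * cnj (v n)))"

lemma continuous_coord_diff: "continuous_on S (\<lambda>x::nat \<Rightarrow> complex. x m - x n)"
  by (intro continuous_on_diff continuous_coord)

lemma herm_form_base: "herm_form (base_form N f q)"
  unfolding base_form_def
  by (intro herm_form_add herm_form_sum_forms herm_form_rank1 continuous_coord continuous_coord_diff)
    (simp_all add: seq_apply algebra_simps)

lemma green:
  assumes "N \<ge> 1" "v \<in> supported N"
  shows "(\<Sum>n=1..N. sl_op f q y n * cnj (v n)) =
    base_form N f q (restr N y) v - of_real (f 0) * y 0 * cnj (v 1)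
      - of_real (f N) * (y (N+1) - y N) * cnj (v N)"
proof -
  define F where "F n = of_real (f n) * (y (n+1) - y n)" for n
  have v0: "v 0 = 0" using assms(2) by (auto simp: supported_def)
  have "(\<Sum>n=1..N. sl_op f q y n * cnj (v n)) =
      (\<Sum>n=1..N. (F (n-1) - F n) * cnj (v n)) + (\<Sum>n=1..N. of_real (q n) * (y n * cnj (v n)))"
    unfolding sum.distrib[symmetric]
    by (rule sum.cong) (auto simp: sl_op_def F_def algebra_simps)
  also have "(\<Sum>n=1..N. of_real (q n) * (y n * cnj (v n))) =
      (\<Sum>n=1..N. of_real (q n) * (restr N y n * cnj (v n)))"
    by (rule sum.cong) (auto simp: restr_def)
  also have "(\<Sum>n=1..N. (F (n-1) - F n) * cnj (v n)) =
      (\<Sum>n=1..N. F (n-1) * cnj (v n - v (n-1))) - F N * cnj (v N)"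
    using summation_by_parts[of F "\<lambda>n. cnj (v n)" N] v0 by simp
  also have "(\<Sum>n=1..N. F (n-1) * cnj (v n - v (n-1))) =
      (\<Sum>n=1..N. of_real (f (n-1)) * ((restr N y n - restr N y (n-1)) * cnj (v n - v (n-1))))
      - of_real (f 0) * y 0 * cnj (v 1)"
  proof -
    \<comment> \<open>The summand \<open>n = 1\<close> is split off because only there does the
      difference reach \<open>y 0\<close>, which the restriction replaces by 0; this is the source
      of the boundary term at 0.\<close>
    have "(\<Sum>n=Suc 1..N. F (n-1) * cnj (v n - v (n-1))) =
        (\<Sum>n=Suc 1..N. of_real (f (n-1)) * ((restr N y n - restr N y (n-1)) * cnj (v n - v (n-1))))"
      by (rule sum.cong) (auto simp: F_def restr_def)
    moreover have "F (1 - 1) * cnj (v 1 - v (1 - 1)) =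
        of_real (f (1 - 1)) * ((restr N y 1 - restr N y (1 - 1)) * cnj (v 1 - v (1 - 1)))
        - of_real (f 0) * y 0 * cnj (v 1)"
      using assms(1) v0 by (simp add: F_def restr_def algebra_simps)
    ultimately show ?thesis
      unfolding sum.atLeast_Suc_atMost[OF assms(1)] by (simp only: diff_conv_add_uminus add_ac)
  qed
  finally show ?thesis by (simp add: base_form_def F_def)
qed

context weighted
begin

text \<open>After summation by parts \<open>y 0\<close> and \<open>y (N+1)\<close> survive only in
  the two boundary terms, where the boundary condition can replace them. Unit sequences as test
  vectors give back the pointwise equation.\<close>

lemma weak_form:
  assumes "N \<ge> 1"
  shows "sl_eq N f q w lam y \<longleftrightarrow> (\<forall>v\<in>supported N. base_form N f q (restr N y) v =
    lam * ip (restr N y) v + of_real (f 0) * y 0 * cnj (v 1)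
      + of_real (f N) * (y (N+1) - y N) * cnj (v N))" (is "_ \<longleftrightarrow> ?W")
proof -
  have ip: "lam * ip (restr N y) v = (\<Sum>n=1..N. lam * of_real (w n) * y n * cnj (v n))" for v
    unfolding ip_def sum_distrib_left by (rule sum.cong) (auto simp: restr_def)
  have W: "?W \<longleftrightarrow> (\<forall>v\<in>supported N. (\<Sum>n=1..N. sl_op f q y n * cnj (v n)) =
      (\<Sum>n=1..N. lam * of_real (w n) * y n * cnj (v n)))"
    unfolding ip[symmetric]
    by (rule ball_cong[OF refl], subst green[OF assms]) (auto simp: algebra_simps)
  show ?thesis
  proof
    assume "sl_eq N f q w lam y"
    thus ?W unfolding W sl_eq_iff by auto
  next
    assume h: ?W
    show "sl_eq N f q w lam y"
      unfolding sl_eq_iff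
    proof
      fix k assume k: "k \<in> {1..N}"
      have "unit_seq k \<in> supported N" using k by (auto simp: unit_seq_def supported_def)
      hence "(\<Sum>n=1..N. sl_op f q y n * cnj (unit_seq k n)) =
          (\<Sum>n=1..N. lam * of_real (w n) * y n * cnj (unit_seq k n))" using h unfolding W by blast
      moreover have "(\<Sum>n=1..N. g n * cnj (unit_seq k n)) = g k" for g :: "nat \<Rightarrow> complex"
      proof -
        have "(\<Sum>n=1..N. g n * cnj (unit_seq k n)) = (\<Sum>n=1..N. if n = k then g n else 0)"
          by (rule sum.cong) (auto simp: unit_seq_def)
        thus ?thesis using k by simp
      qed
      ultimately show "sl_op f q y k = lam * of_real (w k) * y k" by simp
    qed
  qed
qed

text \<open>Here y0 stands for y 0 and D for f N (y (N+1) - y N); neither is seen by the restriction.\<close>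
lemma restr_sol_space:
  assumes N: "N \<ge> 1" and fN: "f N \<noteq> 0"
  shows "restr N ` sol_space N f q w M lam = {x\<in>supported N. \<exists>y0 D.
      (\<forall>i<2. M i 0 * y0 + M i 1 * (of_real (f 0) * (x 1 - y0)) + M i 2 * x N + M i 3 * D = 0) \<and>
      (\<forall>v\<in>supported N. base_form N f q x v =
         lam * ip x v + of_real (f 0) * y0 * cnj (v 1) + D * cnj (v N))}" (is "_ = ?R")
proof (intro equalityI subsetI)
  fix x assume "x \<in> restr N ` sol_space N f q w M lam"
  then obtain y where y: "y \<in> sol_space N f q w M lam" "x = restr N y" by blast
  have "x \<in> supported N" "x 1 = y 1" "x N = y N" using N by (auto simp: y(2) restr_def supported_def)
  moreover have "\<forall>i<2. M i 0 * y 0 + M i 1 * (of_real (f 0) * (x 1 - y 0)) + M i 2 * x N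
      + M i 3 * (of_real (f N) * (y (N+1) - y N)) = 0"
    using y(1) \<open>x 1 = y 1\<close> \<open>x N = y N\<close> by (simp add: sol_space_def bc_holds_def)
  moreover have "\<forall>v\<in>supported N. base_form N f q x v =
         lam * ip x v + of_real (f 0) * y 0 * cnj (v 1) + of_real (f N) * (y (N+1) - y N) * cnj (v N)"
    using y(1) weak_form[OF N, of f q lam y] unfolding y(2) sol_space_def by blast
  ultimately show "x \<in> ?R" by blast
next
  fix x assume "x \<in> ?R"
  then obtain y0 D where x: "x \<in> supported N" and
    bc: "\<forall>i<2. M i 0 * y0 + M i 1 * (of_real (f 0) * (x 1 - y0)) + M i 2 * x N + M i 3 * D = 0" and
    wk: "\<forall>v\<in>supported N. base_form N f q x v =
         lam * ip x v + of_real (f 0) * y0 * cnj (v 1) + D * cnj (v N)" by blast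
  \<comment> \<open>The value at \<open>N+1\<close> is solved from
    \<open>f N * (y (N+1) - y N) = D\<close>, which takes \<open>f N \<noteq> 0\<close>.\<close>
  define y where "y = x(0 := y0, N+1 := x N + D / of_real (f N))"
  have y: "y 0 = y0" "y 1 = x 1" "y N = x N" "of_real (f N) * (y (N+1) - y N) = D"
    using N fN by (auto simp: y_def)
  have r: "restr N y = x" using x by (auto simp: restr_def y_def supported_def)
  have "sl_eq N f q w lam y"
    unfolding weak_form[OF N] r y(1,4) by (rule wk)
  moreover have "bc_holds N f M y"
    unfolding bc_holds_def unfolding y(4) unfolding y(1-3) by (rule bc)
  moreover have "\<forall>n>N+1. y n = 0" using x by (auto simp: y_def supported_def)
  ultimately have "y \<in> sol_space N f q w M lam" by (simp add: sol_space_def)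
  thus "x \<in> restr N ` sol_space N f q w M lam" using r by blast
qed

text \<open>The equation at 1 determines \<open>y 0\<close> and the equation at \<open>N\<close>
  determines \<open>y (N+1)\<close> from the values on 1..N, as \<open>f 0\<close> and
  \<open>f N\<close> are nonzero. With \<open>N \<ge> 2\<close> these are two different equations,
  each containing just one of the outer values.\<close>

lemma dim_sol_space:
  assumes N: "N \<ge> 2" and f0: "f 0 \<noteq> 0" and fN: "f N \<noteq> 0"
  shows "cfun.dim (sol_space N f q w M lam) = cfun.dim (restr N ` sol_space N f q w M lam)"
proof (rule dim_injective_image[symmetric])
  show "Vector_Spaces.linear cscale cscale (restr N)"
    by unfold_locales (auto simp: restr_def seq_apply fun_eq_iff)
  show "cfun.subspace (sol_space N f q w M lam)" by (rule subspace_sol_space)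
  show "inj_on (restr N) (sol_space N f q w M lam)"
  proof (rule inj_onI)
    fix x y assume x: "x \<in> sol_space N f q w M lam" and y: "y \<in> sol_space N f q w M lam"
      and eq: "restr N x = restr N y"
    have mid: "x n = y n" if "n \<in> {1..N}" for n
      using fun_cong[OF eq, of n] that by (simp add: restr_def)
    have ex: "sl_op f q x n = lam * of_real (w n) * x n"
      and ey: "sl_op f q y n = lam * of_real (w n) * y n" if "n \<in> {1..N}" for n
      using x y that by (auto simp: sol_space_def sl_eq_iff)
    have op: "sl_op f q x n = sl_op f q y n" if "n \<in> {1..N}" for n
      using ex[OF that] ey[OF that] mid[OF that] by simp
    have "x 0 = y 0"
      using op[of 1] mid[of 1] mid[of 2] N f0 by (simp add: sl_op_def numeral_2_eq_2)
    moreover have "x (N+1) = y (N+1)"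
      using op[of N] mid[of N] mid[of "N-1"] N fN by (simp add: sl_op_def)
    moreover have "x n = y n" if "n > N + 1" for n using x y that by (simp add: sol_space_def)
    ultimately have "x n = y n" for n
      using mid[of n] by (cases "n = 0 \<or> n = N + 1 \<or> n > N + 1") auto
    thus "x = y" by blast
  qed
qed

end

subsection \<open>Boundary value problems represented by Hermitian forms\<close>

context weighted
begin

text \<open>Equality of dimensions at every complex \<open>lam\<close> suffices, because the
  multiset of eigenvalues is determined by the multiplicities alone.\<close>

definition represents :: "(nat \<Rightarrow> real) \<Rightarrow> (nat \<Rightarrow> real) \<Rightarrow> bcmat \<Rightarrow> (nat \<Rightarrow> complex) set
    \<Rightarrow> ((nat \<Rightarrow> complex) \<Rightarrow> (nat \<Rightarrow> complex) \<Rightarrow> complex) \<Rightarrow> bool" where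
  "represents f q M U h \<longleftrightarrow> herm_form h \<and> cfun.subspace U \<and> closed U \<and> U \<subseteq> supported N \<and>
     (\<forall>lam. cfun.dim (sol_space N f q w M lam) = cfun.dim (eigspace h U lam))"

lemma representsD:
  assumes "represents f q M U h"
  shows "herm_form h" "cfun.subspace U" "closed U" "U \<subseteq> supported N"
    "cfun.dim (sol_space N f q w M lam) = cfun.dim (eigspace h U lam)"
  using assms unfolding represents_def by blast+

lemma represents_eigbasis:
  assumes "represents f q M U h"
  obtains us where "eigbasis h U us"
  using eigbasis_exists[OF representsD(1-4)[OF assms]] .

text \<open>\<open>eig_mset\<close> is a definite description: the eigenvalues along the basis form
  a multiset with the prescribed counts, and counts determine a multiset.\<close>

lemma represents_eig:
  assumes M: "represents f q M U h" and us: "eigbasis h U us"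
  shows "num_eig N f q w M = length us"
    "n < length us \<Longrightarrow> eig N f q w M n = Re (h (us ! n) (us ! n))"
proof -
  let ?\<mu> = "\<lambda>u. Re (h u u)"
  define S where "S = mset (map (\<lambda>u. complex_of_real (?\<mu> u)) us)"
  have dist: "distinct us" and srt: "sorted (map ?\<mu> us)" using us unfolding eigbasis_def by blast+
  have scale: "(\<lambda>(c::complex) (y::nat \<Rightarrow> complex) n. c * y n) = cscale"
    by (simp add: cscale_def fun_eq_iff)
  have cnt: "count S lam = eig_mult N f q w M lam" for lam
  proof -
    have "eig_mult N f q w M lam = card {u\<in>set us. complex_of_real (?\<mu> u) = lam}"
      unfolding eig_mult_def scale representsD(5)[OF M]
      by (rule dim_eigspace[OF representsD(1)[OF M] us representsD(2)[OF M]])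
    also have "\<dots> = length (filter (\<lambda>u. complex_of_real (?\<mu> u) = lam) us)"
      using distinct_card[OF distinct_filter[OF dist]] by simp
    also have "\<dots> = count S lam"
      unfolding S_def by (induction us) auto
    finally show ?thesis ..
  qed
  have "eig_mset N f q w M = S"
    unfolding eig_mset_def
    by (rule the_equality) (auto simp: cnt intro!: multiset_eqI)
  moreover have "image_mset Re S = mset (map ?\<mu> us)"
    unfolding S_def by (simp add: multiset.map_comp comp_def flip: mset_map)
  ultimately have "num_eig N f q w M = length us"
    "sorted_list_of_multiset (image_mset Re (eig_mset N f q w M)) = map ?\<mu> us"
    using srt by (simp add: num_eig_def S_def, simp only: sorted_list_of_multiset_mset sorted_sort_id)
  thus "num_eig N f q w M = length us"
    "n < length us \<Longrightarrow> eig N f q w M n = ?\<mu> (us ! n)"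
    by (simp_all add: eig_def)
qed

lemma represents_num_eig:
  assumes "represents f q M U h"
  shows "num_eig N f q w M = cfun.dim U"
  by (metis assms represents_eigbasis represents_eig(1) eigbasis_basis(4))

lemma represents_mono:
  assumes M1: "represents f1 q1 M1 U1 h1" and M2: "represents f2 q2 M2 U2 h2"
    and sub: "U2 \<subseteq> U1" and le: "\<And>x. x \<in> U2 \<Longrightarrow> Re (h1 x x) \<le> Re (h2 x x)"
    and n: "n < cfun.dim U2"
  shows "eig N f1 q1 w M1 n \<le> eig N f2 q2 w M2 n"
proof -
  obtain us where us: "eigbasis h1 U1 us" by (rule represents_eigbasis[OF M1])
  obtain vs where vs: "eigbasis h2 U2 vs" by (rule represents_eigbasis[OF M2])
  \<comment> \<open>The inclusion of the domains ensures that the first problem has an eigenvalue of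
    index \<open>n\<close> at all.\<close>
  have "set vs \<subseteq> cfun.span (set us)"
    using eigbasis_basis(1)[OF vs] eigbasis_basis(3)[OF us] sub by blast
  hence "card (set vs) \<le> card (set us)"
    using cfun.independent_span_bound[OF _ eigbasis_basis(2)[OF vs]] by blast
  hence "length vs \<le> length us"
    using us vs by (simp add: eigbasis_def distinct_card)
  moreover have n2: "n < length vs" using n eigbasis_basis(4)[OF vs] by simp
  ultimately have n1: "n < length us" by simp
  have "Re (h1 (us ! n) (us ! n)) \<le> Re (h2 (vs ! n) (vs ! n))"
    by (rule eigenvalue_compare[OF representsD(1)[OF M1] us representsD(1)[OF M2] vs
          representsD(2)[OF M2] n1 n2, of "{}"]) (use sub le in auto)
  thus ?thesis using represents_eig(2)[OF M1 us n1] represents_eig(2)[OF M2 vs n2] by simp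
qed

text \<open>The condition \<open>\<phi> x = 0\<close> is one more equation in the min-max argument
  and therefore costs one index.\<close>

lemma represents_interlace:
  assumes M1: "represents f1 q1 M1 U1 h1" and M2: "represents f2 q2 M2 U2 h2"
    and sub: "\<And>x. x \<in> U2 \<Longrightarrow> \<phi> x = 0 \<Longrightarrow> x \<in> U1 \<and> Re (h1 x x) \<le> Re (h2 x x)"
    and lin: "\<And>x y. \<phi> (x + y) = \<phi> x + \<phi> y" "\<And>c x. \<phi> (c *\<^sub>c x) = c * \<phi> x"
    and n: "n < cfun.dim U1" "n + 1 < cfun.dim U2"
  shows "eig N f1 q1 w M1 n \<le> eig N f2 q2 w M2 (n + 1)"
proof -
  obtain us where us: "eigbasis h1 U1 us" by (rule represents_eigbasis[OF M1])
  obtain vs where vs: "eigbasis h2 U2 vs" by (rule represents_eigbasis[OF M2])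
  have n1: "n < length us" and n2: "n + 1 < length vs"
    using n eigbasis_basis(4)[OF us] eigbasis_basis(4)[OF vs] by simp_all
  have "\<phi> 0 = 0" using lin(2)[of 0 0] by simp
  hence sum: "\<phi> (\<Sum>u\<in>A. c u *\<^sub>c u) = (\<Sum>u\<in>A. c u * \<phi> u)" for A c
    by (induction A rule: infinite_finite_induct) (simp_all add: lin)
  have "Re (h1 (us ! n) (us ! n)) \<le> Re (h2 (vs ! (n + 1)) (vs ! (n + 1)))"
    by (rule eigenvalue_compare[OF representsD(1)[OF M1] us representsD(1)[OF M2] vs
          representsD(2)[OF M2] n1 n2, of "{\<phi>}"]) (use sub sum in auto)
  thus ?thesis using represents_eig(2)[OF M1 us n1] represents_eig(2)[OF M2 vs n2] by simp
qed

end

section \<open>The concrete forms, their domains and the three boundary conditions\<close>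

locale sturm_liouville = weighted N w for N w +
  fixes f q :: "nat \<Rightarrow> real" and z :: complex
  assumes N: "N \<ge> 2" and f0: "f 0 \<noteq> 0" and fN: "f N \<noteq> 0"
begin

definition ell :: "(nat \<Rightarrow> complex) \<Rightarrow> complex" where
  "ell x = of_real (f 0) * x 1 - cnj z * x N"

text \<open>The condition at 0 reads t * y 0 = ell y with t = a11 + f 0. Eliminating y 0 subtracts
  |ell|^2 / t from the form if t is nonzero, and restricts it to the kernel of ell if t = 0;
  the convention 1 / 0 = 0 covers the latter, and t = 0 without the restriction gives S3.\<close>
definition sl_form :: "real \<Rightarrow> real \<Rightarrow> (nat \<Rightarrow> complex) \<Rightarrow> (nat \<Rightarrow> complex) \<Rightarrow> complex" where
  "sl_form b t x v = base_form N f q x v + of_real b * (x N * cnj (v N))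
     + of_real (- (1 / t)) * (ell x * cnj (ell v))"

definition domA :: "real \<Rightarrow> (nat \<Rightarrow> complex) set" where
  "domA t = {x\<in>supported N. t = 0 \<longrightarrow> ell x = 0}"

definition domS4 :: "real \<Rightarrow> (nat \<Rightarrow> complex) set" where
  "domS4 t = {x\<in>domA t. x N = 0}"

lemma ell_linear: "ell (x + y) = ell x + ell y" "ell (c *\<^sub>c x) = c * ell x"
  by (simp_all add: ell_def seq_apply algebra_simps)

lemma continuous_ell: "continuous_on UNIV ell"
  unfolding ell_def by (intro continuous_on_diff continuous_on_mult continuous_on_const continuous_coord)

lemma herm_form_sl: "herm_form (sl_form b t)"
  unfolding sl_form_def
  by (intro herm_form_add herm_form_base herm_form_rank1 continuous_coord continuous_ell)
    (simp_all add: seq_apply ell_linear)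

lemma closed_coord: "closed {x::nat \<Rightarrow> complex. x n = 0}"
  by (rule closed_Collect_eq[OF continuous_coord continuous_on_const])

lemma closed_supported: "closed (supported N)"
proof -
  have "supported N = (\<Inter>n\<in>- {1..N}. {x. x n = 0})" by (auto simp: supported_def)
  thus ?thesis by (simp add: closed_INT closed_coord)
qed

lemma dom_closed_subspace:
  "cfun.subspace (domA t)" "closed (domA t)" "domA t \<subseteq> supported N"
  "cfun.subspace (domS4 t)" "closed (domS4 t)" "domS4 t \<subseteq> supported N"
proof -
  have e0: "ell 0 = 0" by (simp add: ell_def zero_fun_apply)
  show A: "cfun.subspace (domA t)"
    using subspace_supported[of N] by (auto simp: domA_def cfun.subspace_def ell_linear e0)
  show "cfun.subspace (domS4 t)"
    using A by (auto simp: domS4_def cfun.subspace_def seq_apply)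
  have "closed {x. ell x = 0}"
    by (rule closed_Collect_eq[OF continuous_ell continuous_on_const])
  moreover have "domA t = (if t = 0 then supported N \<inter> {x. ell x = 0} else supported N)"
    by (auto simp: domA_def)
  ultimately show cA: "closed (domA t)" by (simp add: closed_supported closed_Int)
  have "domS4 t = domA t \<inter> {x. x N = 0}" by (auto simp: domS4_def)
  thus "closed (domS4 t)" by (simp add: closed_coord closed_Int cA)
  show "domA t \<subseteq> supported N" "domS4 t \<subseteq> supported N" by (auto simp: domA_def domS4_def)
qed

lemma dim_domA: "cfun.dim (domA t) = (if t = 0 then N - 1 else N)"
proof (cases "t = 0")
  case True
  \<comment> \<open>On the kernel of \<open>ell\<close> the coordinate \<open>x 1\<close> equals
    \<open>cnj z / f 0 * x N\<close>, so the coordinates 2..N are free and only the vector for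
    \<open>N\<close> needs a correction at 1.\<close>
  define b where "b k = unit_seq k + (if k = N then cnj z / of_real (f 0) else 0) *\<^sub>c unit_seq 1" for k
  have "cfun.dim (domA t) = card {2..N}"
  proof (rule coordinate_basis(2)[where b = b])
    show "b k \<in> domA t" if "k \<in> {2..N}" for k
      using that N f0 True
      by (auto simp: b_def domA_def supported_def ell_def unit_seq_def seq_apply)
    show "b k j = (if j = k then 1 else 0)" if "j \<in> {2..N}" "k \<in> {2..N}" for j k
      using that by (auto simp: b_def unit_seq_def seq_apply)
    fix x assume x: "x \<in> domA t" and 0: "\<And>k. k \<in> {2..N} \<Longrightarrow> x k = 0"
    have "x N = 0" using 0 N by simp
    hence x1: "x 1 = 0" using x True f0 by (simp add: domA_def ell_def)
    have "x n = 0" for n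
    proof (cases "n \<in> {2..N}")
      case False
      hence "n = 1 \<or> n \<notin> {1..N}" by auto
      thus ?thesis using x x1 by (auto simp: domA_def supported_def)
    qed (rule 0)
    thus "x = 0" by (simp add: fun_eq_iff zero_fun_apply)
  qed (simp_all add: dom_closed_subspace)
  thus ?thesis using True by simp
next
  case False
  hence "domA t = supported N" by (auto simp: domA_def)
  thus ?thesis using False supported_unit(2) by simp
qed

lemma dim_domS4: "cfun.dim (domS4 t) = (if t = 0 then N - 2 else N - 1)"
proof -
  \<comment> \<open>Once \<open>x N = 0\<close>, \<open>ell x\<close> reduces to
    \<open>f 0 * x 1\<close>; so \<open>t = 0\<close> removes the coordinate 1 as well. For
    \<open>N = 2\<close> nothing is left.\<close>
  define K where "K = (if t = 0 then {2..N-1} else {1..N-1})"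
  have "cfun.dim (domS4 t) = card K"
  proof (rule coordinate_basis(2)[where b = unit_seq])
    show "unit_seq k \<in> domS4 t" if "k \<in> K" for k
      using that N
      by (auto simp: K_def domS4_def domA_def supported_def ell_def unit_seq_def split: if_splits)
    fix x assume x: "x \<in> domS4 t" and 0: "\<And>k. k \<in> K \<Longrightarrow> x k = 0"
    have xN: "x N = 0" using x by (simp add: domS4_def)
    hence x1: "t = 0 \<Longrightarrow> x 1 = 0" using x f0 by (simp add: domS4_def domA_def ell_def)
    have "x n = 0" for n
    proof (cases "n \<in> K")
      case False
      hence "n = N \<or> n \<notin> {1..N} \<or> t = 0 \<and> n = 1" by (auto simp: K_def split: if_splits)
      thus ?thesis using x xN x1 by (auto simp: domS4_def domA_def supported_def)
    qed (rule 0)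
    thus "x = 0" by (simp add: fun_eq_iff zero_fun_apply)
  qed (auto simp: dom_closed_subspace K_def unit_seq_def)
  thus ?thesis using N by (auto simp: K_def)
qed

lemma representsI:
  assumes "cfun.subspace U" "closed U" "U \<subseteq> supported N"
    and "\<And>lam x. x \<in> eigspace (sl_form b t) U lam \<longleftrightarrow> x \<in> supported N \<and> (\<exists>y0 D.
      (M 0 0 * y0 + M 0 1 * (of_real (f 0) * (x 1 - y0)) + M 0 2 * x N + M 0 3 * D = 0) \<and>
      (M 1 0 * y0 + M 1 1 * (of_real (f 0) * (x 1 - y0)) + M 1 2 * x N + M 1 3 * D = 0) \<and>
      (\<forall>v\<in>supported N. base_form N f q x v =
         lam * ip x v + of_real (f 0) * y0 * cnj (v 1) + D * cnj (v N)))"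
  shows "represents f q M U (sl_form b t)"
proof -
  have two: "(\<forall>i<2. P i) \<longleftrightarrow> P 0 \<and> P 1" for P :: "nat \<Rightarrow> bool"
    by (auto simp: less_2_cases_iff)
  have "restr N ` sol_space N f q w M lam = eigspace (sl_form b t) U lam" for lam
  proof -
    have "N \<ge> 1" using N by simp
    note r = restr_sol_space[of f, OF this fN, unfolded two]
    show ?thesis unfolding r by (rule set_eqI) (simp only: mem_Collect_eq assms(4) conj_assoc)
  qed
  thus ?thesis
    using assms(1-3) herm_form_sl N f0 fN dim_sol_space by (auto simp: represents_def)
qed

lemma unit_supported: "k \<in> {1..N} \<Longrightarrow> unit_seq k \<in> supported N"
  by (auto simp: unit_seq_def supported_def)

text \<open>The residual of the eigenvalue equation is conjugate linear in the test vector. If it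
  vanishes on a domain cut out by linear conditions, it is a combination of these conditions, and
  the multipliers supply the missing boundary values.\<close>

lemma residual_conj_linear:
  assumes h: "herm_form h"
  shows "h x (v + v') - lam * ip x (v + v') = (h x v - lam * ip x v) + (h x v' - lam * ip x v')"
    "h x (c *\<^sub>c v) - lam * ip x (c *\<^sub>c v) = cnj c * (h x v - lam * ip x v)"
  by (simp_all add: herm_formD(3,4)[OF h] herm_formD(3,4)[OF herm_form_ip] algebra_simps)

lemma represents_S3: "represents f q (bcS3 b) (supported N) (sl_form b 0)"
proof (rule representsI)
  fix lam x
  show "x \<in> eigspace (sl_form b 0) (supported N) lam \<longleftrightarrow> x \<in> supported N \<and> (\<exists>y0 D.
      (bcS3 b 0 0 * y0 + bcS3 b 0 1 * (of_real (f 0) * (x 1 - y0)) + bcS3 b 0 2 * x N + bcS3 b 0 3 * D = 0) \<and>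
      (bcS3 b 1 0 * y0 + bcS3 b 1 1 * (of_real (f 0) * (x 1 - y0)) + bcS3 b 1 2 * x N + bcS3 b 1 3 * D = 0) \<and>
      (\<forall>v\<in>supported N. base_form N f q x v =
         lam * ip x v + of_real (f 0) * y0 * cnj (v 1) + D * cnj (v N)))" (is "?L \<longleftrightarrow> ?R")
  proof
    assume ?L
    thus ?R
      \<comment> \<open>\<open>D\<close> is solved from the second row; moved to the left side it
        becomes the \<open>b\<close> term of the form.\<close>
      by (intro conjI exI[of _ 0] exI[of _ "- of_real b * x N"])
        (auto simp: eigspace_def sl_form_def bcS3_def algebra_simps)
  next
    assume ?R
    then obtain D where x: "x \<in> supported N" and D: "of_real b * x N + D = 0" and
      h: "\<forall>v\<in>supported N. base_form N f q x v = lam * ip x v + D * cnj (v N)"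
      by (auto simp: bcS3_def)
    have "D = - of_real b * x N" using D by (simp add: eq_neg_iff_add_eq_0 add.commute)
    thus ?L using x h by (auto simp: eigspace_def sl_form_def algebra_simps)
  qed
qed (simp_all add: subspace_supported closed_supported)

lemma represents_A: "represents f q (bcA z a b) (domA (a + f 0)) (sl_form b (a + f 0))"
proof (rule representsI)
  fix lam x
  define t where "t = a + f 0"
  define g where "g v = base_form N f q x v + of_real b * (x N * cnj (v N)) - lam * ip x v" for v
  show "x \<in> eigspace (sl_form b (a + f 0)) (domA (a + f 0)) lam \<longleftrightarrow> x \<in> supported N \<and> (\<exists>y0 D.
      (bcA z a b 0 0 * y0 + bcA z a b 0 1 * (of_real (f 0) * (x 1 - y0)) + bcA z a b 0 2 * x N + bcA z a b 0 3 * D = 0) \<and>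
      (bcA z a b 1 0 * y0 + bcA z a b 1 1 * (of_real (f 0) * (x 1 - y0)) + bcA z a b 1 2 * x N + bcA z a b 1 3 * D = 0) \<and>
      (\<forall>v\<in>supported N. base_form N f q x v =
         lam * ip x v + of_real (f 0) * y0 * cnj (v 1) + D * cnj (v N)))" (is "?L \<longleftrightarrow> ?R")
  proof -
    \<comment> \<open>The second row gives \<open>D = - z * y0 - b * x N\<close>, whereupon the
      terms with \<open>y0\<close> combine to \<open>y0 * cnj (ell v)\<close>. That the functional
      \<open>ell\<close> of the first row reappears here reflects the self-adjointness of the
      boundary condition.\<close>
    have "?R \<longleftrightarrow> x \<in> supported N \<and> (\<exists>y0. of_real t * y0 = ell x \<and>
        (\<forall>v\<in>supported N. g v = y0 * cnj (ell v)))" (is "_ \<longleftrightarrow> ?R'")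
    proof
      assume ?R
      then obtain y0 D where x: "x \<in> supported N" and
        1: "of_real a * y0 - of_real (f 0) * (x 1 - y0) + cnj z * x N = 0" and
        2: "z * y0 + of_real b * x N + D = 0" and
        3: "\<forall>v\<in>supported N. base_form N f q x v =
         lam * ip x v + of_real (f 0) * y0 * cnj (v 1) + D * cnj (v N)"
        by (auto simp: bcA_def)
      have D: "D = - (z * y0) - of_real b * x N" using 2 by (simp add: algebra_simps eq_neg_iff_add_eq_0)
      have "of_real t * y0 = ell x" using 1 by (simp add: t_def ell_def algebra_simps)
      moreover have "\<forall>v\<in>supported N. g v = y0 * cnj (ell v)"
        using 3 by (auto simp: g_def D ell_def algebra_simps)
      ultimately show ?R' using x by blast
    next
      assume ?R'
      then obtain y0 where x: "x \<in> supported N" and 1: "of_real t * y0 = ell x" and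
        3: "\<forall>v\<in>supported N. g v = y0 * cnj (ell v)" by blast
      define D where "D = - (z * y0) - of_real b * x N"
      have "of_real a * y0 - of_real (f 0) * (x 1 - y0) + cnj z * x N = 0"
        using 1 by (simp add: t_def ell_def algebra_simps)
      moreover have "z * y0 + of_real b * x N + D = 0" by (simp add: D_def)
      moreover have "base_form N f q x v =
         lam * ip x v + of_real (f 0) * y0 * cnj (v 1) + D * cnj (v N)" if "v \<in> supported N" for v
      proof -
        have "g v = y0 * cnj (ell v)" using 3 that by blast
        thus ?thesis by (simp add: g_def D_def ell_def algebra_simps)
      qed
      ultimately show ?R
        by (intro conjI[OF x] exI[of _ y0] exI[of _ D]) (auto simp: bcA_def)
    qed
    also have "\<dots> \<longleftrightarrow> x \<in> eigspace (sl_form b t) (domA t) lam"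
    proof (cases "t = 0")
      case False
      have "(\<exists>y0. of_real t * y0 = ell x \<and> (\<forall>v\<in>supported N. g v = y0 * cnj (ell v))) \<longleftrightarrow>
          (\<forall>v\<in>supported N. g v = ell x / of_real t * cnj (ell v))"
      proof
        assume "\<forall>v\<in>supported N. g v = ell x / of_real t * cnj (ell v)"
        thus "\<exists>y0. of_real t * y0 = ell x \<and> (\<forall>v\<in>supported N. g v = y0 * cnj (ell v))"
          using False by (intro exI[of _ "ell x / of_real t"]) simp
      qed (use False in \<open>auto simp: field_simps\<close>)
      moreover have "domA t = supported N" using False by (auto simp: domA_def)
      ultimately show ?thesis
        unfolding eigspace_def by (auto simp: g_def sl_form_def algebra_simps)
    next
      case True
      have g: "g v = sl_form b t x v - lam * ip x v" for v
        by (simp add: g_def sl_form_def True)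
      have ga: "g (v + v') = g v + g v'" "g (c *\<^sub>c v) = cnj c * g v" for v v' c
        unfolding g by (rule residual_conj_linear[OF herm_form_sl])+
      show ?thesis
      proof
        assume "x \<in> supported N \<and> (\<exists>y0. of_real t * y0 = ell x \<and>
          (\<forall>v\<in>supported N. g v = y0 * cnj (ell v)))"
        hence "x \<in> domA t" "\<forall>v\<in>domA t. g v = 0" by (auto simp: domA_def True)
        thus "x \<in> eigspace (sl_form b t) (domA t) lam" by (simp add: eigspace_def g)
      next
        assume "x \<in> eigspace (sl_form b t) (domA t) lam"
        hence x: "x \<in> domA t" and 0: "\<And>v. v \<in> domA t \<Longrightarrow> g v = 0" by (auto simp: eigspace_def g)
        \<comment> \<open>For \<open>t = 0\<close> the value \<open>y0\<close> is a Lagrange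
          multiplier: since \<open>ell (unit_seq 1) = f 0\<close>, subtracting a multiple of
          \<open>unit_seq 1\<close> moves \<open>v\<close> into the kernel of \<open>ell\<close>,
          where \<open>g\<close> vanishes, and \<open>g (unit_seq 1)\<close> determines the
          factor.\<close>
        have "g v = g (unit_seq 1) / of_real (f 0) * cnj (ell v)" if v: "v \<in> supported N" for v
        proof -
          define c where "c = ell v / of_real (f 0)"
          have "ell (unit_seq 1) = of_real (f 0)" using N by (simp add: ell_def unit_seq_def)
          hence "ell (v + (- c) *\<^sub>c unit_seq 1) = ell v + - c * of_real (f 0)"
            by (simp only: ell_linear)
          hence "ell (v + (- c) *\<^sub>c unit_seq 1) = 0" using f0 by (simp add: c_def)
          moreover have "v + (- c) *\<^sub>c unit_seq 1 \<in> supported N"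
            using N by (intro cfun.subspace_add cfun.subspace_scale subspace_supported v unit_supported) auto
          ultimately have "g (v + (- c) *\<^sub>c unit_seq 1) = 0"
            by (intro 0) (simp add: domA_def)
          hence "g v + cnj (- c) * g (unit_seq 1) = 0" by (simp only: ga)
          thus ?thesis using f0 by (simp add: c_def field_simps)
        qed
        thus "x \<in> supported N \<and> (\<exists>y0. of_real t * y0 = ell x \<and>
          (\<forall>v\<in>supported N. g v = y0 * cnj (ell v)))"
          using x True by (intro conjI exI[of _ "g (unit_seq 1) / of_real (f 0)"] ballI) (auto simp: domA_def)
      qed
    qed
    finally show ?thesis unfolding t_def by blast
  qed
qed (rule dom_closed_subspace)+

text \<open>The \<open>b\<close> term vanishes when \<open>x N = 0\<close>, so \<open>b\<close> is
  free; choosing it as in \<open>bcA z a b\<close> gives both problems the same form.\<close>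

lemma represents_S4: "represents f q (bcS4 a) (domS4 (a + f 0)) (sl_form b (a + f 0))"
proof (rule representsI)
  fix lam x
  define t where "t = a + f 0"
  define g where "g v = sl_form b t x v - lam * ip x v" for v
  have ga: "g (v + v') = g v + g v'" "g (c *\<^sub>c v) = cnj c * g v" for v v' c
    unfolding g_def by (rule residual_conj_linear[OF herm_form_sl])+
  show "x \<in> eigspace (sl_form b (a + f 0)) (domS4 (a + f 0)) lam \<longleftrightarrow> x \<in> supported N \<and> (\<exists>y0 D.
      (bcS4 a 0 0 * y0 + bcS4 a 0 1 * (of_real (f 0) * (x 1 - y0)) + bcS4 a 0 2 * x N + bcS4 a 0 3 * D = 0) \<and>
      (bcS4 a 1 0 * y0 + bcS4 a 1 1 * (of_real (f 0) * (x 1 - y0)) + bcS4 a 1 2 * x N + bcS4 a 1 3 * D = 0) \<and>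
      (\<forall>v\<in>supported N. base_form N f q x v =
         lam * ip x v + of_real (f 0) * y0 * cnj (v 1) + D * cnj (v N)))" (is "?L \<longleftrightarrow> ?R")
  proof
    assume ?R
    then obtain y0 D where x: "x \<in> supported N" and xN: "x N = 0" and
      1: "of_real a * y0 - of_real (f 0) * (x 1 - y0) = 0" and
      3: "\<forall>v\<in>supported N. base_form N f q x v =
         lam * ip x v + of_real (f 0) * y0 * cnj (v 1) + D * cnj (v N)"
      by (auto simp: bcS4_def)
    have t: "of_real t * y0 = ell x" using 1 xN by (simp add: t_def ell_def algebra_simps)
    have "g v = 0" if v: "v \<in> domS4 t" for v
    proof -
      have "base_form N f q x v = lam * ip x v + y0 * cnj (ell v)"
        using 3 v by (auto simp: domS4_def domA_def ell_def)
      hence "g v = y0 * cnj (ell v) - of_real (1 / t) * (ell x * cnj (ell v))"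
        using xN by (simp add: g_def sl_form_def)
      also have "\<dots> = 0"
        using v by (cases "t = 0") (auto simp: domS4_def domA_def t[symmetric])
      finally show ?thesis .
    qed
    moreover have "x \<in> domS4 t" using x xN t by (auto simp: domS4_def domA_def)
    ultimately show ?L unfolding t_def[symmetric] eigspace_def by (simp add: g_def)
  next
    assume ?L
    hence x: "x \<in> domS4 t" and 0: "\<And>v. v \<in> domS4 t \<Longrightarrow> g v = 0"
      unfolding t_def[symmetric] by (auto simp: eigspace_def g_def)
    have xN: "x N = 0" and xs: "x \<in> supported N" using x by (auto simp: domS4_def domA_def)
    have u: "unit_seq 1 \<in> supported N" "unit_seq N \<in> supported N"
      using N by (auto intro!: unit_supported)
    have bg: "base_form N f q x v = g v + lam * ip x v + of_real (1 / t) * (ell x * cnj (ell v))" for v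
      using xN by (simp add: g_def sl_form_def)
    \<comment> \<open>\<open>D\<close> is the multiplier of the constraint \<open>x N = 0\<close>.
      For nonzero \<open>t\<close> its summand \<open>- y0 * z\<close> absorbs the
      \<open>v N\<close> part of \<open>cnj (ell v)\<close>; for \<open>t = 0\<close> the domain
      also forces \<open>x 1 = 0\<close>, and \<open>y0\<close> is the multiplier of that
      constraint.\<close>
    have "\<exists>y0 D. of_real t * y0 = ell x \<and> (\<forall>v\<in>supported N. base_form N f q x v =
         lam * ip x v + of_real (f 0) * y0 * cnj (v 1) + D * cnj (v N))"
    proof (cases "t = 0")
      case False
      define y0 where "y0 = ell x / of_real t"
      have "base_form N f q x v = lam * ip x v + of_real (f 0) * y0 * cnj (v 1)
          + (g (unit_seq N) - y0 * z) * cnj (v N)" if v: "v \<in> supported N" for v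
      proof -
        let ?v = "v + (- v N) *\<^sub>c unit_seq N"
        have "?v \<in> supported N"
          by (intro cfun.subspace_add cfun.subspace_scale subspace_supported v u)
        moreover have "?v N = 0" by (simp add: seq_apply unit_seq_def)
        ultimately have "?v \<in> domS4 t" using False by (simp add: domS4_def domA_def)
        from 0[OF this] have "g v + cnj (- v N) * g (unit_seq N) = 0" by (simp only: ga)
        hence "g v = cnj (v N) * g (unit_seq N)" by simp
        moreover have "of_real (1 / t) * (ell x * cnj (ell v)) = y0 * (of_real (f 0) * cnj (v 1) - z * cnj (v N))"
          by (simp add: y0_def ell_def[of v])
        ultimately show ?thesis unfolding bg by (simp add: algebra_simps)
      qed
      thus ?thesis using False by (intro exI[of _ y0] exI[of _ "g (unit_seq N) - y0 * z"]) (auto simp: y0_def)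
    next
      case True
      have "base_form N f q x v = lam * ip x v + of_real (f 0) * (g (unit_seq 1) / of_real (f 0)) * cnj (v 1)
          + g (unit_seq N) * cnj (v N)" if v: "v \<in> supported N" for v
      proof -
        let ?v = "v + ((- v 1) *\<^sub>c unit_seq 1 + (- v N) *\<^sub>c unit_seq N)"
        have "?v \<in> supported N"
          by (intro cfun.subspace_add cfun.subspace_scale subspace_supported v u)
        moreover have "?v 1 = 0" "?v N = 0" using N by (auto simp: seq_apply unit_seq_def)
        ultimately have "?v \<in> domS4 t" by (simp add: domS4_def domA_def ell_def)
        from 0[OF this]
        have "g v + (cnj (- v 1) * g (unit_seq 1) + cnj (- v N) * g (unit_seq N)) = 0"
          by (simp only: ga)
        hence "g v = cnj (v 1) * g (unit_seq 1) + cnj (v N) * g (unit_seq N)"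
          by (simp add: algebra_simps eq_neg_iff_add_eq_0)
        thus ?thesis using f0 by (simp add: bg True)
      qed
      moreover have "of_real t * (g (unit_seq 1) / of_real (f 0)) = ell x"
        using x True by (simp add: domS4_def domA_def)
      ultimately show ?thesis by blast
    qed
    then obtain y0 D where 1: "of_real t * y0 = ell x" and 3: "\<forall>v\<in>supported N. base_form N f q x v =
         lam * ip x v + of_real (f 0) * y0 * cnj (v 1) + D * cnj (v N)" by blast
    have "of_real a * y0 - of_real (f 0) * (x 1 - y0) = 0"
      using 1 xN by (simp add: t_def ell_def algebra_simps)
    thus ?R using xs xN 3
      by (intro conjI[OF xs] exI[of _ y0] exI[of _ D]) (auto simp: bcS4_def)
  qed
qed (rule dom_closed_subspace)+

section \<open>Eigenvalue counts and comparison inequalities\<close>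

lemma sl_form_Re:
  "Re (sl_form b t x x) = Re (base_form N f q x x) + b * (cmod (x N))\<^sup>2 - (cmod (ell x))\<^sup>2 / t"
proof -
  have "sl_form b t x x = base_form N f q x x + of_real (b * (cmod (x N))\<^sup>2 - (cmod (ell x))\<^sup>2 / t)"
    by (simp add: sl_form_def complex_norm_square del: of_real_power)
  thus ?thesis by simp
qed

lemma eig_num:
  "num_eig N f q w (bcA z a b) = (if a \<noteq> - f 0 then N else N - 1)"
  "num_eig N f q w (bcS3 b) = N"
  "num_eig N f q w (bcS4 a) = (if a \<noteq> - f 0 then N - 1 else N - 2)"
  using represents_num_eig[OF represents_A, of a b] represents_num_eig[OF represents_S3]
    represents_num_eig[OF represents_S4[where b = b], of a]
  by (auto simp: dim_domA dim_domS4 supported_unit eq_neg_iff_add_eq_0)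

text \<open>\<open>1 / t\<close> is decreasing on each side of its pole, so both parameters have to
  lie on the same side of \<open>- f 0\<close>.\<close>

lemma eig_A_mono_a:
  assumes "a < a'" "a' < - f 0 \<or> - f 0 < a" "n < N"
  shows "eig N f q w (bcA z a b) n \<le> eig N f q w (bcA z a' b) n"
proof (rule represents_mono[OF represents_A represents_A])
  have t: "a + f 0 \<noteq> 0" "a' + f 0 \<noteq> 0" using assms by auto
  show "domA (a' + f 0) \<subseteq> domA (a + f 0)" using t by (simp add: domA_def)
  show "n < cfun.dim (domA (a' + f 0))" using t assms(3) by (simp add: dim_domA)
  have "1 / (a' + f 0) \<le> 1 / (a + f 0)"
    using assms(2)
  proof
    assume "a' < - f 0"
    thus ?thesis using assms(1) by (auto simp: divide_inverse intro!: le_imp_inverse_le_neg)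
  next
    assume "- f 0 < a"
    thus ?thesis using assms(1) by (auto simp: divide_inverse intro!: le_imp_inverse_le)
  qed
  hence "(cmod (ell x))\<^sup>2 * (1 / (a' + f 0)) \<le> (cmod (ell x))\<^sup>2 * (1 / (a + f 0))" for x
    by (rule mult_left_mono) simp
  thus "Re (sl_form b (a + f 0) x x) \<le> Re (sl_form b (a' + f 0) x x)" for x
    by (simp add: sl_form_Re)
qed

text \<open>On the kernel of \<open>ell\<close> the \<open>1 / t\<close> term vanishes whatever the
  sign of \<open>t\<close>, so the critical problem is a restriction of the problem for
  \<open>a\<close> on either side of \<open>- f 0\<close>.\<close>

lemma eig_A_le_critical:
  assumes "n + 1 < N"
  shows "eig N f q w (bcA z a b) n \<le> eig N f q w (bcA z (- f 0) b) n"
  by (rule represents_mono[OF represents_A represents_A])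
    (use assms in \<open>auto simp: dim_domA, auto simp: domA_def sl_form_Re\<close>)

text \<open>The same restriction read backwards, with \<open>ell\<close> as the single linear
  condition.\<close>

lemma eig_A_critical_le:
  assumes "n + 1 < N" "a \<noteq> - f 0"
  shows "eig N f q w (bcA z (- f 0) b) n \<le> eig N f q w (bcA z a b) (n + 1)"
  by (rule represents_interlace[OF represents_A represents_A _ ell_linear])
    (use assms in \<open>auto simp: dim_domA, auto simp: domA_def sl_form_Re\<close>)

text \<open>The term \<open>- |ell x|^2 / t\<close>, absent for S3, is nonpositive for
  \<open>t > 0\<close>; for \<open>t < 0\<close> it is nonnegative, which gives the opposite
  inequality next.\<close>

lemma eig_A_le_S3:
  assumes "- f 0 < a" "n < N"
  shows "eig N f q w (bcA z a b) n \<le> eig N f q w (bcS3 b) n"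
  by (rule represents_mono[OF represents_A represents_S3])
    (use assms in \<open>auto simp: supported_unit domA_def sl_form_Re\<close>)

lemma eig_S3_le_A:
  assumes "a < - f 0" "n < N"
  shows "eig N f q w (bcS3 b) n \<le> eig N f q w (bcA z a b) n"
  by (rule represents_mono[OF represents_S3 represents_A])
    (use assms in \<open>auto simp: dim_domA, auto simp: domA_def sl_form_Re divide_nonneg_neg\<close>)

lemma eig_A_mono_b:
  assumes "b < b'" "n < (if a = - f 0 then N - 1 else N)"
  shows "eig N f q w (bcA z a b) n \<le> eig N f q w (bcA z a b') n"
  by (rule represents_mono[OF represents_A represents_A])
    (use assms in \<open>auto simp: dim_domA sl_form_Re mult_right_mono split: if_splits\<close>)

text \<open>With a common \<open>b\<close> the two forms coincide and the domain of S4 is cut out by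
  \<open>x N = 0\<close>. The bound on \<open>n\<close> is the dimension of that domain.\<close>

lemma eig_A_le_S4:
  assumes "n < (if a = - f 0 then N - 2 else N - 1)"
  shows "eig N f q w (bcA z a b) n \<le> eig N f q w (bcS4 a) n"
  by (rule represents_mono[OF represents_A represents_S4[where b = b]])
    (use assms in \<open>auto simp: dim_domS4 split: if_splits, auto simp: domS4_def\<close>)

lemma eig_S4_le_A:
  assumes "n < (if a = - f 0 then N - 2 else N - 1)"
  shows "eig N f q w (bcS4 a) n \<le> eig N f q w (bcA z a b) (n + 1)"
  by (rule represents_interlace[OF represents_S4[where b = b] represents_A, where \<phi> = "\<lambda>x. x N"])
    (use assms in \<open>auto simp: dim_domS4 dim_domA seq_apply split: if_splits, auto simp: domS4_def\<close>)

end

theorem theorem3p3: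
  fixes N :: nat and f q w :: "nat \<Rightarrow> real" and z :: complex
  assumes hN: "N \<ge> 2"
    and hf: "\<forall>n\<le>N. f n \<noteq> 0"
    and hw: "\<forall>n\<in>{1..N}. w n > 0"
  shows
    "(\<forall>a11 b21. num_eig N f q w (bcA z a11 b21) = (if a11 \<noteq> - f 0 then N else N - 1))
   \<and> (\<forall>b21. num_eig N f q w (bcS3 b21) = N)
   \<and> (\<forall>a11. num_eig N f q w (bcS4 a11) = (if a11 \<noteq> - f 0 then N - 1 else N - 2))
   \<and> (\<forall>a1 a2 a3 a4 b21. a1 < a2 \<and> a2 \<le> - f 0 \<and> - f 0 < a3 \<and> a3 < a4 \<longrightarrow>
        (let l = (\<lambda>a n. eig N f q w (bcA z a b21) n); s = eig N f q w (bcS3 b21) in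
          (\<forall>n<N. l a3 n \<le> l a4 n \<and> l a4 n \<le> s n \<and> s n \<le> l a1 n)
        \<and> (\<forall>n. n + 1 < N \<longrightarrow> l a1 n \<le> l a2 n \<and> l a2 n \<le> l a3 (n + 1))
        \<and> (a2 < - f 0 \<longrightarrow> l a1 (N - 1) \<le> l a2 (N - 1))))
   \<and> (\<forall>a11 b1 b2. b1 < b2 \<longrightarrow>
        (let l = (\<lambda>b n. eig N f q w (bcA z a11 b) n); s = eig N f q w (bcS4 a11) in
          (\<forall>n. n + 2 < N \<longrightarrow> l b1 n \<le> l b2 n \<and> l b2 n \<le> s n \<and> s n \<le> l b1 (n + 1))
        \<and> l b1 (N - 2) \<le> l b2 (N - 2)
        \<and> (a11 \<noteq> - f 0 \<longrightarrow>
             l b2 (N - 2) \<le> s (N - 2) \<and> s (N - 2) \<le> l b1 (N - 1) \<and> l b1 (N - 1) \<le> l b2 (N - 1))))"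
proof -
  interpret sturm_liouville N w f q z
    by unfold_locales (use hN hf hw in auto)
  have i: "eig N f q w (bcA z a1 b) n \<le> eig N f q w (bcA z a2 b) n
      \<and> eig N f q w (bcA z a2 b) n \<le> eig N f q w (bcA z a3 b) (n + 1)"
    if "a1 < a2" "a2 \<le> - f 0" "- f 0 < a3" "n + 1 < N" for a1 a2 a3 b n
  proof
    show "eig N f q w (bcA z a1 b) n \<le> eig N f q w (bcA z a2 b) n"
      using eig_A_mono_a[of a1 a2 n b] eig_A_le_critical[of n a1 b] that
      by (cases "a2 = - f 0") auto
    \<comment> \<open>The pole of \<open>1 / t\<close> is crossed by way of the critical problem:
      restricting to the kernel of \<open>ell\<close> raises the eigenvalue from \<open>a2\<close>,
      and releasing it towards \<open>a3\<close> shifts the index.\<close>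
    show "eig N f q w (bcA z a2 b) n \<le> eig N f q w (bcA z a3 b) (n + 1)"
      using order_trans[OF eig_A_le_critical[of n a2 b] eig_A_critical_le[of n a3 b]] that by auto
  qed
  have ii: "eig N f q w (bcA z a b) n \<le> eig N f q w (bcA z a b') n"
    if "b < b'" "Suc n < N \<or> a \<noteq> - f 0 \<and> n < N" for a b b' n
    using eig_A_mono_b[of b b' n a] that by (cases "a = - f 0") auto
  have iii: "eig N f q w (bcA z a b) n \<le> eig N f q w (bcS4 a) n"
    "eig N f q w (bcS4 a) n \<le> eig N f q w (bcA z a b) (Suc n)"
    if "Suc (Suc n) < N \<or> a \<noteq> - f 0 \<and> Suc n < N" for a b n
    using eig_A_le_S4[of n a b] eig_S4_le_A[of n a b] that by (cases "a = - f 0"; auto)+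
  \<comment> \<open>Brings the top index into successor form, so that the interlacing with S4
    applies at \<open>n = N - 2\<close>.\<close>
  have last: "N - Suc 0 = Suc (N - 2)" using hN by simp
  show ?thesis
    unfolding Let_def
    by (intro conjI allI impI)
      (use hN in \<open>auto simp: eig_num last intro: eig_A_mono_a eig_A_le_S3 eig_S3_le_A
        i[THEN conjunct1] i[THEN conjunct2, simplified] ii iii\<close>)
qed

end
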